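(* Let $\mathbf t\in\Sigma^\circ$ and let $\mathbf y\in(\Sigma^* )^\circ$ be the gradient certificate of $\mathbf t$. Let $\{\mathbf z_1,\dots,\mathbf z_s\}\subseteq S_{\mathbf w}$ be a finite point set that is unisolvent for $\mathcal V$, let $\alpha_1,\dots,\alpha_s>0$, and let $\mathbf M=\sum_{i=1}^s\alpha_i\,\mathbf q(\mathbf z_i)\mathbf q(\mathbf z_i)^{\mathrm T}$. Let $$N=\left\lceil\frac32\sqrt{U\operatorname{cond}(\mathbf M)}\,\|\mathbf t\|_2\right\rceil.$$ Then every $\mathbf y_N\in\frac1N\mathbb Z^U$ with $\|\mathbf y_N-\mathbf y\|_2\le\frac{\sqrt U}{2N}$ is a dual certificate of $\mathbf t$.
   Context: Fix $n\ge1$, nonzero polynomials $\mathbf w=(w_1,\dots,w_m)$ in $\mathbb R[z_1,\dots,z_n]$ and nonnegative integers $\mathbf d=(d_1,\dots,d_m)$. $\mathcal V_{n,k}$ is the space of real $n$-variate polynomials of degree at most $k$; $\Sigma_{n,2k}$ is the cone of sums of squares of elements of $\mathcal V_{n,k}$. Let $\mathcal V=\{\sum_i w_ir_i: r_i\in\mathcal V_{n,2d_i}\}$, $U=\dim\mathcal V$, and $\Sigma=\{\sum_i w_i\sigma_i:\sigma_i\in\Sigma_{n,2d_i}\}\subseteq\mathcal V$ (weighted sums of squares). Let $S_{\mathbf w}=\{\mathbf z\in\mathbb R^n: w_i(\mathbf z)\ge0,\ i=1,\dots,m\}$. Fix an ordered basis $\mathbf q=(q_1,\dots,q_U)$ of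 $\mathcal V$ and ordered bases $\mathbf p_i$ of $\mathcal V_{n,d_i}$, $L_i=\dim\mathcal V_{n,d_i}$. Polynomials in $\mathcal V$ are identified with their coefficient vectors in the basis $\mathbf q$, so $\Sigma\subseteq\mathbb R^U$; $\Sigma^*=\{\mathbf y\in\mathbb R^U:\mathbf x^{\mathrm T}\mathbf y\ge0\ \forall\mathbf x\in\Sigma\}$. $\Lambda_i:\mathbb R^U\to\mathbb S^{L_i}$ is the unique linear map to symmetric matrices with $\Lambda_i(\mathbf q(\mathbf z))=w_i(\mathbf z)\mathbf p_i(\mathbf z)\mathbf p_i(\mathbf z)^{\mathrm T}$ for all $\mathbf z$, and $\Lambda=\Lambda_1\oplus\cdots\oplus\Lambda_m$ (block diagonal). Standing assumption: $\Sigma$ is closed and pointed, so $\Sigma$ and $\Sigma^*$ are closed, pointed cones with nonempty interiors $\Sigma^\circ,(\Sigma^* )^\circ$, and $\Sigma^*=\{\mathbf x:\Lambda(\mathbf x)\succcurlyeq0\}$, $(\Sigma^* )^\circ=\{\mathbf x:\Lambda(\mathbf x)\succ0\}$. Barrier function: $f(\mathbf x)=-\ln\det\Lambda(\mathbf x)$ on $(\Sigma^* )^\circ$, with gradient $g$ and (positive definite) Hessian $H$. A vector $\mathbf x\in(\Sigma^* )^\circ$ is a dual certificate of $\mathbf s\in\Sigma$ if $H(\mathbf x)^{-1}\mathbf s\in\Sigma^*$. The map $-g$ is a bijection $(\Sigma^* )^\circ\to\Sigma^\circ$; the gradient certificate of $\mathbf s\in\Sigma^\circ$ is the unique $\mathbf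 x\in(\Sigma^* )^\circ$ with $-g(\mathbf x)=\mathbf s$. A set $S$ is unisolvent for $\mathcal V$ if every polynomial in $\mathcal V$ is uniquely determined by its values on $S$. $\operatorname{cond}(\mathbf M)=\lambda_{\max}(\mathbf M)/\lambda_{\min}(\mathbf M)$. *)

theory Defs
  imports "HOL-Analysis.Analysis" "HOL-Analysis.Finite_Function_Topology"
begin

text \<open>
  A polynomial in the variables indexed by \<^typ>\<open>'n\<close> is the finitely supported map from exponent vectors to coefficients. Its ring
  structure (convolution) comes from \<^theory>\<open>HOL-Library.Poly_Mapping\<close>, its real
  vector space structure from \<^theory>\<open>HOL-Analysis.Finite_Function_Topology\<close>.
\<close>

type_synonym 'n mpoly = "('n \<Rightarrow>\<^sub>0 nat) \<Rightarrow>\<^sub>0 real"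

definition mpoly_eval :: "'n::finite mpoly \<Rightarrow> real^'n \<Rightarrow> real" where
  "mpoly_eval r z =
     (\<Sum>e\<in>Poly_Mapping.keys r. Poly_Mapping.lookup r e * (\<Prod>i\<in>UNIV. (z $ i) ^ Poly_Mapping.lookup e i))"

definition polys_le :: "nat \<Rightarrow> 'n::finite mpoly set" where
  "polys_le k = {r. \<forall>e\<in>Poly_Mapping.keys r. (\<Sum>i\<in>UNIV. Poly_Mapping.lookup e i) \<le> k}"

text \<open>
  Sums of squares of polynomials of degree at most \<open>k\<close>; the parameter is half the degree of
  the resulting polynomials.
\<close>

definition sos_cone :: "nat \<Rightarrow> 'n::finite mpoly set" where
  "sos_cone k = {(\<Sum>r\<leftarrow>rs. r\<^sup>2) | rs. set rs \<subseteq> polys_le k}"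

definition weighted_space :: "('m::finite \<Rightarrow> 'n::finite mpoly) \<Rightarrow> ('m \<Rightarrow> nat) \<Rightarrow> 'n mpoly set" where
  "weighted_space w d = {(\<Sum>i\<in>UNIV. w i * r i) | r. \<forall>i. r i \<in> polys_le (2 * d i)}"

definition weighted_sos :: "('m::finite \<Rightarrow> 'n::finite mpoly) \<Rightarrow> ('m \<Rightarrow> nat) \<Rightarrow> 'n mpoly set" where
  "weighted_sos w d = {(\<Sum>i\<in>UNIV. w i * \<sigma> i) | \<sigma>. \<forall>i. \<sigma> i \<in> sos_cone (d i)}"

definition nonneg_set :: "('m::finite \<Rightarrow> 'n::finite mpoly) \<Rightarrow> (real^'n) set" where
  "nonneg_set w = {z. \<forall>i. mpoly_eval (w i) z \<ge> 0}"

definition unisolvent :: "(real^'n::finite) set \<Rightarrow> 'n mpoly set \<Rightarrow> bool" where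
  "unisolvent S V \<longleftrightarrow>
     (\<forall>r1\<in>V. \<forall>r2\<in>V. (\<forall>z\<in>S. mpoly_eval r1 z = mpoly_eval r2 z) \<longrightarrow> r1 = r2)"

definition basis_family :: "'a set \<Rightarrow> ('a \<Rightarrow> 'v::real_vector) \<Rightarrow> 'v set \<Rightarrow> bool" where
  "basis_family I b V \<longleftrightarrow> inj_on b I \<and> independent (b ` I) \<and> span (b ` I) = V"

definition from_coords :: "('u::finite \<Rightarrow> 'v::real_vector) \<Rightarrow> real^'u \<Rightarrow> 'v" where
  "from_coords q x = (\<Sum>j\<in>UNIV. (x $ j) *\<^sub>R q j)"

definition eval_vec :: "('u::finite \<Rightarrow> 'n::finite mpoly) \<Rightarrow> real^'n \<Rightarrow> real^'u" where
  "eval_vec q z = (\<chi> j. mpoly_eval (q j) z)"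

definition Sigma_cone ::
  "('u::finite \<Rightarrow> 'n::finite mpoly) \<Rightarrow> ('m::finite \<Rightarrow> 'n mpoly) \<Rightarrow> ('m \<Rightarrow> nat) \<Rightarrow> (real^'u) set" where
  "Sigma_cone q w d = {x. from_coords q x \<in> weighted_sos w d}"

definition dual_cone :: "'a::real_inner set \<Rightarrow> 'a set" where
  "dual_cone K = {y. \<forall>x\<in>K. x \<bullet> y \<ge> 0}"

definition pointed :: "'a::real_vector set \<Rightarrow> bool" where
  "pointed K \<longleftrightarrow> (\<forall>x. x \<in> K \<and> - x \<in> K \<longrightarrow> x = 0)"

definition outer :: "real^'a::finite \<Rightarrow> real^'a^'a" where
  "outer v = (\<chi> a b. v $ a * v $ b)"

text \<open>
  The rows of the block-diagonal matrix are indexed by \<^typ>\<open>'l\<close>, the disjoint union of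
  the index sets of the bases \<open>p\<^sub>i\<close>: \<open>blk a\<close> is the block to which row \<open>a\<close> belongs, and
  \<open>p\<^sub>i\<close> is the restriction of \<open>p\<close> to \<open>{a. blk a = i}\<close>. The vector \<open>p\<^sub>i(z)\<close> and the matrix
  \<open>\<Lambda>\<^sub>i(x)\<close> are padded with zeros outside block \<open>i\<close>, so the direct sum of the \<open>\<Lambda>\<^sub>i\<close> is their sum.
\<close>

definition block_eval_vec ::
  "('l::finite \<Rightarrow> 'm) \<Rightarrow> ('l \<Rightarrow> 'n::finite mpoly) \<Rightarrow> 'm \<Rightarrow> real^'n \<Rightarrow> real^'l" where
  "block_eval_vec blk p i z = (\<chi> a. if blk a = i then mpoly_eval (p a) z else 0)"

definition Lambda_block ::
  "('u::finite \<Rightarrow> 'n::finite mpoly) \<Rightarrow> ('m::finite \<Rightarrow> 'n mpoly) \<Rightarrow> ('l::finite \<Rightarrow> 'm) \<Rightarrow>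
   ('l \<Rightarrow> 'n mpoly) \<Rightarrow> 'm \<Rightarrow> real^'u \<Rightarrow> real^'l^'l" where
  "Lambda_block q w blk p i =
     (THE L. linear L \<and>
        (\<forall>z. L (eval_vec q z) = mpoly_eval (w i) z *\<^sub>R outer (block_eval_vec blk p i z)))"

definition Lambda ::
  "('u::finite \<Rightarrow> 'n::finite mpoly) \<Rightarrow> ('m::finite \<Rightarrow> 'n mpoly) \<Rightarrow> ('l::finite \<Rightarrow> 'm) \<Rightarrow>
   ('l \<Rightarrow> 'n mpoly) \<Rightarrow> real^'u \<Rightarrow> real^'l^'l" where
  "Lambda q w blk p x = (\<Sum>i\<in>UNIV. Lambda_block q w blk p i x)"

definition barrier ::
  "('u::finite \<Rightarrow> 'n::finite mpoly) \<Rightarrow> ('m::finite \<Rightarrow> 'n mpoly) \<Rightarrow> ('l::finite \<Rightarrow> 'm) \<Rightarrow>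
   ('l \<Rightarrow> 'n mpoly) \<Rightarrow> real^'u \<Rightarrow> real" where
  "barrier q w blk p x = - ln (det (Lambda q w blk p x))"

definition gradient :: "('a::real_inner \<Rightarrow> real) \<Rightarrow> 'a \<Rightarrow> 'a" where
  "gradient f x = (THE D. GDERIV f x :> D)"

definition hessian :: "(real^'u::finite \<Rightarrow> real) \<Rightarrow> real^'u \<Rightarrow> real^'u^'u" where
  "hessian f x = jacobian (gradient f) (at x)"

definition dual_certificate ::
  "('u::finite \<Rightarrow> 'n::finite mpoly) \<Rightarrow> ('m::finite \<Rightarrow> 'n mpoly) \<Rightarrow> ('m \<Rightarrow> nat) \<Rightarrow>
   ('l::finite \<Rightarrow> 'm) \<Rightarrow> ('l \<Rightarrow> 'n mpoly) \<Rightarrow> real^'u \<Rightarrow> real^'u \<Rightarrow> bool" where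
  "dual_certificate q w d blk p x s \<longleftrightarrow>
     s \<in> Sigma_cone q w d \<and>
     x \<in> interior (dual_cone (Sigma_cone q w d)) \<and>
     matrix_inv (hessian (barrier q w blk p) x) *v s \<in> dual_cone (Sigma_cone q w d)"

definition gradient_certificate ::
  "('u::finite \<Rightarrow> 'n::finite mpoly) \<Rightarrow> ('m::finite \<Rightarrow> 'n mpoly) \<Rightarrow> ('m \<Rightarrow> nat) \<Rightarrow>
   ('l::finite \<Rightarrow> 'm) \<Rightarrow> ('l \<Rightarrow> 'n mpoly) \<Rightarrow> real^'u \<Rightarrow> real^'u \<Rightarrow> bool" where
  "gradient_certificate q w d blk p x s \<longleftrightarrow>
     s \<in> interior (Sigma_cone q w d) \<and>
     x \<in> interior (dual_cone (Sigma_cone q w d)) \<and>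
     - gradient (barrier q w blk p) x = s"

definition eigenvalues :: "real^'a^'a::finite \<Rightarrow> real set" where
  "eigenvalues A = {c. \<exists>v. v \<noteq> 0 \<and> A *v v = c *\<^sub>R v}"

text \<open>Meant for symmetric positive definite matrices: only real eigenvalues are taken into account.\<close>

definition cond_number :: "real^'a^'a::finite \<Rightarrow> real" where
  "cond_number A = Max (eigenvalues A) / Min (eigenvalues A)"

end

theory Submission
  imports Defs "HOL-Computational_Algebra.Polynomial"
begin

text \<open>
  Let \<open>C\<close> satisfy \<open>C\<^sup>T \<Lambda>(y) C = I\<close>; the local norm of \<open>v\<close> at \<open>y\<close> is the Frobenius norm of
  \<open>C\<^sup>T \<Lambda>(v) C\<close>, and \<open>t \<bullet> v = tr (C\<^sup>T \<Lambda>(v) C)\<close> because \<open>t = -g(y)\<close>. A point \<open>x\<close> with local distance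
  \<open>r < 1\<close> from \<open>y\<close> is a dual certificate of \<open>t\<close>: the local norm at \<open>x\<close> of \<open>H(x)\<inverse> t - x\<close> is at
  most \<open>r\<close>, and the Dikin ellipsoid around \<open>x\<close> lies in the dual cone.

  The local norm is compared with the Euclidean norm by writing \<open>v\<close> as a combination of the
  vectors \<open>q(z\<^sub>i)\<close>. On these, \<open>\<Lambda>\<close> is positive semidefinite, so the local norm is at most
  \<open>t \<bullet> q(z\<^sub>i)\<close>, and the Cauchy-Schwarz inequality gives the factor \<open>sqrt (cond M) * norm t\<close>. The
  bound on \<open>norm (yN - y)\<close> then yields \<open>r \<le> 1/3\<close>.
\<close>

section \<open>Positive definite matrices and congruence\<close>

lemma outer_component: "outer v $ i $ j = v $ i * v $ j"
  by (simp add: outer_def)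

lemma inner_outer: "A \<bullet> outer v = v \<bullet> (A *v v)"
  by (simp add: inner_vec_def outer_def matrix_vector_mult_def sum_distrib_left mult_ac)

lemma outer_inner_outer: "outer v \<bullet> outer u = (v \<bullet> u)\<^sup>2"
  by (simp add: inner_vec_def outer_def power2_eq_square sum_product mult_ac)

lemma norm_outer: "norm (outer v) = v \<bullet> v"
  by (simp add: norm_eq_sqrt_inner outer_inner_outer)

lemma outer_mult_vec: "outer v *v x = (v \<bullet> x) *\<^sub>R v"
  by (simp add: vec_eq_iff matrix_vector_mult_def outer_def inner_vec_def sum_distrib_left mult_ac)

lemma transpose_outer: "transpose (outer v) = outer v"
  by (simp add: transpose_def outer_def mult.commute vec_eq_iff)

lemma mat_1_inner_outer: "mat 1 \<bullet> outer v = v \<bullet> v"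
  by (simp add: inner_outer)

lemma inner_matrix_trace: "A \<bullet> B = trace (transpose A ** (B::real^'n^'n))"
proof -
  have "A \<bullet> B = (\<Sum>i\<in>UNIV. \<Sum>j\<in>UNIV. A$i$j * B$i$j)"
    by (simp add: inner_vec_def)
  also have "\<dots> = (\<Sum>j\<in>UNIV. \<Sum>i\<in>UNIV. A$i$j * B$i$j)"
    by (rule sum.swap)
  finally show ?thesis
    by (simp add: trace_def matrix_matrix_mult_def transpose_def)
qed

lemma trace_eq_inner: "trace (A::real^'n^'n) = mat 1 \<bullet> A"
  by (simp add: inner_matrix_trace transpose_mat)

text \<open>The matrix of the form \<open>E\<close> after the substitution
  \<open>v = C *v u\<close>. A \<open>C\<close> with \<open>congr C A = mat 1\<close> stands in for
  an inverse square root of \<open>A\<close>.\<close>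

definition congr :: "real^'a^'b \<Rightarrow> real^'b^'b \<Rightarrow> real^'a^'a" where
  "congr C E = transpose C ** E ** C"

lemma linear_congr: "linear (congr C)"
  by (rule linearI)
    (simp_all add: congr_def vec_eq_iff matrix_matrix_mult_def sum.distrib algebra_simps sum_distrib_left)

lemma congr_bilinear: "u \<bullet> (congr C E *v v) = (C *v u) \<bullet> (E *v (C *v v))"
proof -
  have "congr C E *v v = transpose C *v (E *v (C *v v))"
    by (simp add: congr_def matrix_vector_mul_assoc matrix_mul_assoc)
  then show ?thesis
    by (metis dot_lmul_matrix inner_commute transpose_matrix_vector)
qed

lemma congr_outer: "congr C (outer v) = outer (transpose C *v v)"
proof -
  have "congr C (outer v) *v x = outer (transpose C *v v) *v x" for x
  proof -
    have "congr C (outer v) *v x = transpose C *v (outer v *v (C *v x))"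
      by (simp add: congr_def matrix_vector_mul_assoc matrix_mul_assoc)
    also have "\<dots> = (v \<bullet> (C *v x)) *\<^sub>R (transpose C *v v)"
      by (simp add: outer_mult_vec matrix_vector_mult_scaleR)
    also have "v \<bullet> (C *v x) = (transpose C *v v) \<bullet> x"
      by (metis dot_lmul_matrix transpose_matrix_vector)
    finally show ?thesis by (simp add: outer_mult_vec)
  qed
  then show ?thesis by (simp add: matrix_eq)
qed

definition pos_def :: "real^'n^'n \<Rightarrow> bool" where
  "pos_def A \<longleftrightarrow> transpose A = A \<and> (\<forall>v. v \<noteq> 0 \<longrightarrow> v \<bullet> (A *v v) > 0)"

lemma sym_inner_commute:
  fixes A :: "real^'n^'n"
  assumes "transpose A = A"
  shows "x \<bullet> (A *v y) = y \<bullet> (A *v x)"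
  by (metis assms dot_lmul_matrix inner_commute transpose_matrix_vector)

text \<open>Gram-Schmidt for the inner product given by \<open>A\<close>: normalise one nonzero
  vector of \<open>S\<close> and recurse into its \<open>A\<close>-orthogonal complement
  \<open>T\<close> in \<open>S\<close>, which has smaller dimension.\<close>

lemma pos_def_orthonormal_basis:
  fixes A :: "real^'n^'n"
  assumes A: "pos_def A" and "subspace S"
  shows "\<exists>B\<subseteq>S. independent B \<and> span B = S \<and> (\<forall>b\<in>B. \<forall>b'\<in>B. b \<bullet> (A *v b') = (if b = b' then 1 else 0))"
  using assms(2)
proof (induction "dim S" arbitrary: S rule: less_induct)
  case less
  show ?case
  proof (cases "S = {0}")
    case True
    then show ?thesis by (intro exI[of _ "{}"]) (auto simp: independent_empty)
  next
    case False
    then obtain v0 where v0: "v0 \<in> S" "v0 \<noteq> 0"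
      using less.prems subspace_0 by blast
    define c where "c = v0 \<bullet> (A *v v0)"
    have "c > 0" using A v0 by (auto simp: pos_def_def c_def)
    define v where "v = (1 / sqrt c) *\<^sub>R v0"
    have vS: "v \<in> S" by (simp add: v_def less.prems subspace_scale v0)
    have v1: "v \<bullet> (A *v v) = 1"
      using \<open>c > 0\<close> by (simp add: v_def matrix_vector_mult_scaleR c_def[symmetric] real_sqrt_mult[symmetric])
    have sym: "x \<bullet> (A *v y) = y \<bullet> (A *v x)" for x y
      using A sym_inner_commute by (auto simp: pos_def_def)
    define T where "T = {x \<in> S. v \<bullet> (A *v x) = 0}"
    have T: "subspace T"
      using less.prems by (auto simp: T_def subspace_def matrix_vector_right_distrib inner_add_right
          matrix_vector_mult_scaleR)
    have "v \<notin> T" using v1 by (simp add: T_def)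
    then have "dim T < dim S"
      using vS T less.prems by (metis (no_types, lifting) T_def dim_psubset mem_Collect_eq psubsetI span_eq_iff subsetI)
    from less.hyps[OF this T] obtain B where B: "B \<subseteq> T" "independent B" "span B = T"
        "\<forall>b\<in>B. \<forall>b'\<in>B. b \<bullet> (A *v b') = (if b = b' then 1 else 0)" by blast
    have "v \<notin> B" using B \<open>v \<notin> T\<close> by auto
    have "S \<subseteq> span (insert v B)"
    proof
      fix x assume x: "x \<in> S"
      have "x - (v \<bullet> (A *v x)) *\<^sub>R v \<in> T"
        using x vS v1 less.prems by (simp add: T_def subspace_diff subspace_scale
            matrix_vector_mult_diff_distrib matrix_vector_mult_scaleR inner_diff_right)
      then show "x \<in> span (insert v B)"
        using B(3) by (auto simp: span_insert)
    qed
    moreover have "span (insert v B) \<subseteq> S"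
      using vS B(1) less.prems by (intro span_minimal) (auto simp: T_def)
    moreover have "independent (insert v B)"
      using B \<open>v \<notin> T\<close> by (simp add: independent_insert)
    moreover have "\<forall>b\<in>insert v B. \<forall>b'\<in>insert v B. b \<bullet> (A *v b') = (if b = b' then 1 else 0)"
      using B v1 \<open>v \<notin> B\<close> sym by (auto simp: T_def)
    ultimately show ?thesis
      by (intro exI[of _ "insert v B"]) (use vS B(1) in \<open>auto simp: T_def\<close>)
  qed
qed

text \<open>The columns of \<open>C\<close> are an \<open>A\<close>-orthonormal basis, so the
  entries of \<open>congr C A\<close> are their mutual \<open>A\<close>-inner products.\<close>

lemma pos_def_congr_identity:
  fixes A :: "real^'n^'n"
  assumes "pos_def A"
  obtains C :: "real^'n^'n" where "congr C A = mat 1"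
proof -
  obtain B where B: "independent B" "span B = (UNIV :: (real^'n) set)"
    "\<forall>b\<in>B. \<forall>b'\<in>B. b \<bullet> (A *v b') = (if b = b' then 1 else 0)"
    using pos_def_orthonormal_basis[OF assms subspace_UNIV] by blast
  have "card B = CARD('n)"
    using B by (metis dim_UNIV dim_eq_card_independent DIM_cart DIM_real dim_span mult.right_neutral)
  then obtain f where f: "bij_betw f (UNIV::'n set) B"
    using finite_same_card_bij[OF finite[of "UNIV :: 'n set"] independent_imp_finite[OF B(1)]] by auto
  define C :: "real^'n^'n" where "C = (\<chi> i j. f j $ i)"
  have Cf: "C *v axis i 1 = f i" for i
    by (simp add: matrix_vector_mult_basis column_def C_def vec_eq_iff)
  have "congr C A $ i $ j = f i \<bullet> (A *v f j)" for i j
  proof -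
    have "congr C A $ i $ j = axis i 1 \<bullet> (congr C A *v axis j 1)"
      by (simp add: inner_axis' matrix_vector_mult_basis column_def)
    then show ?thesis by (simp add: congr_bilinear Cf)
  qed
  moreover have "f i = f j \<longleftrightarrow> i = j" for i j
    using f by (auto simp: bij_betw_def inj_on_def)
  moreover have "f i \<in> B" for i
    using f by (auto simp: bij_betw_def)
  ultimately have "congr C A = mat 1"
    using B(3) by (simp add: vec_eq_iff mat_def)
  then show ?thesis by (rule that)
qed

lemma matrix_inv_eqI:
  fixes A B :: "real^'n^'n"
  assumes "A ** B = mat 1"
  shows "matrix_inv A = B"
proof -
  have BA: "B ** A = mat 1"
    using assms by (rule matrix_left_right_inverse[THEN iffD1])
  have "A ** matrix_inv A = mat 1 \<and> matrix_inv A ** A = mat 1"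
    unfolding matrix_inv_def by (rule someI[of _ B]) (use assms BA in blast)
  then have "B = B ** (A ** matrix_inv A)" by simp
  then show ?thesis by (simp add: matrix_mul_assoc BA)
qed

text \<open>For square matrices a one-sided inverse is two-sided, so the factors of
  \<open>C^T A C = I\<close> may be rotated cyclically.\<close>

lemma congr_identity_inverse:
  fixes A C :: "real^'n^'n"
  assumes "congr C A = mat 1"
  shows "A ** (C ** transpose C) = mat 1"
proof -
  have "(transpose C ** A) ** C = mat 1"
    using assms by (simp add: congr_def)
  then have "C ** (transpose C ** A) = mat 1"
    by (rule matrix_left_right_inverse[THEN iffD1])
  then have "(C ** transpose C) ** A = mat 1"
    by (simp add: matrix_mul_assoc)
  then show ?thesis
    by (rule matrix_left_right_inverse[THEN iffD1])
qed

lemmas congr_identity_matrix_inv = congr_identity_inverse[THEN matrix_inv_eqI]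

lemma congr_identity_det_pos:
  fixes A C :: "real^'n^'n"
  assumes "congr C A = mat 1"
  shows "det A > 0"
proof -
  have "det (congr C A) = (det C)\<^sup>2 * det A"
    by (simp add: congr_def det_mul power2_eq_square mult_ac)
  then show ?thesis
    by (metis assms det_I not_one_le_zero power2_less_eq_zero_iff zero_le_power2 zero_less_mult_pos
        zero_less_one mult_eq_0_iff less_le power2_eq_square)
qed

text \<open>Since the inverse of \<open>A\<close> is \<open>C C^T\<close>, cyclicity of the trace
  moves one \<open>C\<close> to the far end. This rewrites the gradient of the
  log-determinant.\<close>

lemma trace_inverse_eq_inner_congr:
  fixes A C E :: "real^'n^'n"
  assumes "congr C A = mat 1"
  shows "trace (matrix_inv A ** E) = mat 1 \<bullet> congr C E"
proof -
  have "trace (matrix_inv A ** E) = trace (C ** (transpose C ** E))"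
    by (simp add: congr_identity_matrix_inv[OF assms] matrix_mul_assoc)
  also have "\<dots> = trace (congr C E)"
    by (subst trace_mul_sym) (simp add: congr_def)
  finally show ?thesis by (simp add: trace_eq_inner)
qed

lemma transpose_congr: "transpose (congr C E) = congr C (transpose E)"
  by (simp add: congr_def matrix_transpose_mul matrix_mul_assoc)

text \<open>The same cyclicity with two inverses: the Hessian form of \<open>-ln det\<close> becomes
  the Frobenius inner product of the transformed matrices, which is the local inner product.\<close>

lemma trace_inverse_twice_eq_inner_congr:
  fixes A C E F :: "real^'n^'n"
  assumes "congr C A = mat 1" "transpose E = E"
  shows "trace (matrix_inv A ** E ** matrix_inv A ** F) = congr C E \<bullet> congr C F"
proof -
  have "trace (matrix_inv A ** E ** matrix_inv A ** F) = trace (C ** (transpose C ** E ** C ** transpose C ** F))"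
    by (simp add: congr_identity_matrix_inv[OF assms(1)] matrix_mul_assoc)
  also have "\<dots> = trace (congr C E ** congr C F)"
    by (subst trace_mul_sym) (simp add: congr_def matrix_mul_assoc)
  also have "\<dots> = congr C E \<bullet> congr C F"
    by (simp add: inner_matrix_trace transpose_congr assms(2))
  finally show ?thesis .
qed

text \<open>\<open>v^T (A - I) v\<close> is the Frobenius pairing of \<open>A - I\<close> with
  \<open>outer v\<close>, whose norm is \<open>|v|^2\<close>; Cauchy-Schwarz does the rest.\<close>

lemma near_identity_quadratic:
  fixes A :: "real^'n^'n"
  shows "v \<bullet> (A *v v) \<ge> (1 - norm (A - mat 1)) * (v \<bullet> v)"
proof -
  have "(A - mat 1) \<bullet> outer v = v \<bullet> (A *v v) - v \<bullet> v"
    by (simp add: inner_outer matrix_vector_mult_diff_rdistrib inner_diff_right)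
  moreover have "\<bar>(A - mat 1) \<bullet> outer v\<bar> \<le> norm (A - mat 1) * (v \<bullet> v)"
    using Cauchy_Schwarz_ineq2[of "A - mat 1" "outer v"] by (simp add: norm_outer)
  ultimately show ?thesis
    by (simp add: algebra_simps)
qed

lemma congr_identity_surj:
  fixes A C :: "real^'n^'n"
  assumes "congr C A = mat 1"
  obtains u where "v = C *v u"
proof -
  have "C ** (transpose C ** A) = mat 1"
    using assms unfolding congr_def by (rule matrix_left_right_inverse[THEN iffD1])
  then have "v = C *v ((transpose C ** A) *v v)"
    by (simp add: matrix_vector_mul_assoc)
  then show ?thesis by (rule that)
qed

text \<open>As \<open>C\<close> is onto, a form that vanishes after the substitution vanishes on all
  pairs of vectors.\<close>

lemma congr_identity_inj:
  fixes A C E :: "real^'n^'n"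
  assumes "congr C A = mat 1" "congr C E = 0"
  shows "E = 0"
proof -
  have "v \<bullet> (E *v v') = 0" for v v'
  proof -
    obtain u u' where "v = C *v u" "v' = C *v u'"
      using congr_identity_surj[OF assms(1)] by metis
    then show ?thesis
      using congr_bilinear[of u C E u'] by (simp add: assms(2))
  qed
  then have "E *v v' = 0" for v'
    by (metis inner_eq_zero_iff)
  then show ?thesis
    by (simp add: matrix_eq)
qed

text \<open>Every \<open>v\<close> has the form \<open>C u\<close>, and the transformed form is
  bounded below by \<open>1 - norm\<close> times \<open>|u|^2\<close>. The closed unit ball of the
  local norm thus gives semidefiniteness, the open one definiteness in the next lemma.\<close>

lemma congr_near_identity_psd:
  fixes A C E :: "real^'n^'n"
  assumes "congr C A = mat 1" "norm (congr C E - mat 1) \<le> 1"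
  shows "v \<bullet> (E *v v) \<ge> 0"
proof -
  obtain u where u: "v = C *v u"
    using congr_identity_surj[OF assms(1)] .
  have "0 \<le> (1 - norm (congr C E - mat 1)) * (u \<bullet> u)"
    using assms(2) by simp
  also have "\<dots> \<le> u \<bullet> (congr C E *v u)"
    by (rule near_identity_quadratic)
  finally show ?thesis
    by (simp add: congr_bilinear u)
qed

lemma congr_near_identity_pos_def:
  fixes A C E :: "real^'n^'n"
  assumes "congr C A = mat 1" "norm (congr C E - mat 1) < 1" "transpose E = E"
  shows "pos_def E"
  unfolding pos_def_def
proof (intro conjI allI impI)
  fix v :: "real^'n" assume "v \<noteq> 0"
  obtain u where u: "v = C *v u"
    using congr_identity_surj[OF assms(1)] .
  with \<open>v \<noteq> 0\<close> have "u \<noteq> 0" by auto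
  then have "0 < (1 - norm (congr C E - mat 1)) * (u \<bullet> u)"
    using assms(2) by simp
  also have "\<dots> \<le> u \<bullet> (congr C E *v u)"
    by (rule near_identity_quadratic)
  finally show "v \<bullet> (E *v v) > 0"
    by (simp add: congr_bilinear u)
qed (fact assms(3))

text \<open>
  With \<open>K = C'\<inverse> C\<close> we have \<open>congr C X = K\<^sup>T K\<close>, and \<open>Z = K K\<^sup>T\<close> has the same spectrum.
\<close>
lemma norm_congr_swap:
  fixes X Y C C' :: "real^'n^'n"
  assumes C: "congr C Y = mat 1" and C': "congr C' X = mat 1"
  obtains Z where "norm (Z - mat 1) = norm (congr C X - mat 1)"
    "\<And>F. Z \<bullet> congr C' F = mat 1 \<bullet> congr C F"
proof -
  \<comment> \<open>\<open>D\<close> is the inverse of \<open>C'\<close>, which makes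
    \<open>X = D^T D\<close>.\<close>
  define D where "D = transpose C' ** X"
  have DC: "D ** C' = mat 1"
    using C' by (simp add: congr_def D_def)
  then have CD: "C' ** D = mat 1"
    by (rule matrix_left_right_inverse[THEN iffD1])
  have X: "X = transpose D ** D"
  proof -
    have "transpose D ** D = transpose D ** transpose C' ** X"
      by (simp add: D_def matrix_mul_assoc)
    also have "transpose D ** transpose C' = mat 1"
      by (metis CD matrix_transpose_mul transpose_mat)
    finally show ?thesis by simp
  qed
  define K where "K = D ** C"
  define Z where "Z = K ** transpose K"
  have Xc: "congr C X = transpose K ** K"
    by (simp add: congr_def X K_def matrix_transpose_mul matrix_mul_assoc)
  \<comment> \<open>The distance of a symmetric \<open>S\<close> to the identity depends only on the
    traces of \<open>S\<close> and \<open>S^2\<close>, so cyclicity of the trace replaces a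
    comparison of spectra.\<close>
  have sq: "(norm (S - mat 1))\<^sup>2 = trace (S ** S) - 2 * trace S + trace (mat 1 :: real^'n^'n)"
    if "transpose S = S" for S :: "real^'n^'n"
  proof -
    have "(norm (S - mat 1))\<^sup>2 = S \<bullet> S - 2 * (mat 1 \<bullet> S) + mat 1 \<bullet> (mat 1 :: real^'n^'n)"
      by (simp add: power2_norm_eq_inner inner_diff_left inner_diff_right inner_commute)
    then show ?thesis
      using that by (simp add: inner_matrix_trace transpose_mat)
  qed
  have "trace (Z ** Z) = trace ((transpose K ** K) ** (transpose K ** K))"
    unfolding Z_def by (subst (2) trace_mul_sym[symmetric]) (metis matrix_mul_assoc trace_mul_sym)
  moreover have "trace Z = trace (transpose K ** K)"
    unfolding Z_def by (rule trace_mul_sym)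
  ultimately have "(norm (Z - mat 1))\<^sup>2 = (norm (transpose K ** K - mat 1))\<^sup>2"
    by (simp add: sq Z_def matrix_transpose_mul)
  then have 1: "norm (Z - mat 1) = norm (congr C X - mat 1)"
    by (simp add: Xc)
  have 2: "Z \<bullet> congr C' F = mat 1 \<bullet> congr C F" for F
  proof -
    have KC: "C' ** K = C"
      by (simp add: K_def matrix_mul_assoc CD)
    have "Z \<bullet> congr C' F = trace (K ** (transpose K ** congr C' F))"
      by (simp add: inner_matrix_trace Z_def matrix_transpose_mul matrix_mul_assoc)
    also have "\<dots> = trace (congr (C' ** K) F)"
      by (subst trace_mul_sym) (simp add: congr_def matrix_transpose_mul matrix_mul_assoc)
    finally show ?thesis
      by (simp add: KC trace_eq_inner)
  qed
  from that[OF 1 2] show ?thesis .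
qed

section \<open>Extreme eigenvalues of symmetric matrices\<close>

text \<open>A maximiser \<open>v\<close> of the quadratic form on the compact unit sphere is an
  eigenvector, and homogeneity extends the bound to all vectors.\<close>

lemma rayleigh_max_eigenvalue:
  fixes A :: "real^'n^'n"
  assumes A: "transpose A = A"
  obtains c where "c \<in> eigenvalues A" "\<And>x. x \<bullet> (A *v x) \<le> c * (x \<bullet> x)"
proof -
  have "compact (sphere (0::real^'n) 1)" "sphere (0::real^'n) 1 \<noteq> {}"
    by auto
  moreover have "continuous_on (sphere (0::real^'n) 1) (\<lambda>x. x \<bullet> (A *v x))"
    by (intro continuous_intros linear_continuous_on linear_linear[THEN iffD1] matrix_vector_mul_linear)
  ultimately obtain v where "v \<in> sphere (0::real^'n) 1" "\<forall>x\<in>sphere 0 1. x \<bullet> (A *v x) \<le> v \<bullet> (A *v v)"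
    using continuous_attains_sup by blast
  then have v: "norm v = 1" and vmax: "norm x = 1 \<Longrightarrow> x \<bullet> (A *v x) \<le> v \<bullet> (A *v v)" for x
    by auto
  define c where "c = v \<bullet> (A *v v)"
  have bound: "x \<bullet> (A *v x) \<le> c * (x \<bullet> x)" for x
  proof (cases "x = 0")
    case False
    then have "sgn x \<bullet> (A *v sgn x) \<le> c"
      using vmax[of "sgn x"] by (simp add: norm_sgn c_def)
    moreover have "sgn x \<bullet> (A *v sgn x) = (x \<bullet> (A *v x)) / (x \<bullet> x)"
      using False by (simp add: sgn_div_norm matrix_vector_mult_scaleR field_simps
          dot_square_norm power2_eq_square)
    ultimately show ?thesis
      using False by (simp add: field_simps)
  qed simp
  \<comment> \<open>\<open>r\<close> is the part of \<open>A v\<close> orthogonal to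
    \<open>v\<close>; it has to be shown zero.\<close>
  define r where "r = A *v v - c *\<^sub>R v"
  have vv: "v \<bullet> v = 1" using v by (simp add: dot_square_norm)
  have rv: "r \<bullet> v = 0"
    using vv by (simp add: r_def inner_diff_left c_def inner_commute[of "A *v v" v])
  have rA: "r \<bullet> (A *v v) = r \<bullet> r"
    using rv by (simp add: r_def inner_diff_right)
  define k where "k = c * (r \<bullet> r) - r \<bullet> (A *v r)"
  \<comment> \<open>The bound at the perturbed vector \<open>v + e r\<close>: its linear term in
    \<open>e\<close> must be absorbed by the quadratic one for every \<open>e\<close>.\<close>
  have ineq: "2 * e * (r \<bullet> r) \<le> e\<^sup>2 * k" for e
  proof -
    have vr: "v \<bullet> r = 0" using rv by (simp add: inner_commute)
    have vA: "v \<bullet> (A *v r) = r \<bullet> r" using rA sym_inner_commute[OF A, of v r] by simp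
    have "(v + e *\<^sub>R r) \<bullet> (A *v (v + e *\<^sub>R r)) = c + 2 * e * (r \<bullet> r) + e\<^sup>2 * (r \<bullet> (A *v r))"
      using rA vA
      by (simp add: inner_add_left inner_add_right matrix_vector_right_distrib matrix_vector_mult_scaleR
          c_def power2_eq_square algebra_simps)
    moreover have "(v + e *\<^sub>R r) \<bullet> (v + e *\<^sub>R r) = 1 + e\<^sup>2 * (r \<bullet> r)"
      using rv vr vv by (simp add: inner_add_left inner_add_right power2_eq_square)
    ultimately show ?thesis
      using bound[of "v + e *\<^sub>R r"] by (simp add: k_def algebra_simps)
  qed
  \<comment> \<open>Otherwise \<open>e = 1\<close> forces \<open>k > 0\<close>, and then
    \<open>e = (r \<bullet> r) / k\<close> gives \<open>2 c \<le> c\<close> for a positive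
    \<open>c\<close>.\<close>
  have "r \<bullet> r = 0"
  proof (rule ccontr)
    assume "r \<bullet> r \<noteq> 0"
    then have pos: "r \<bullet> r > 0" by simp
    then have "k > 0"
      using ineq[of 1] by (simp del: inner_gt_zero_iff)
    then show False
      using ineq[of "(r \<bullet> r) / k"] mult_pos_pos[OF pos pos]
      by (simp add: power2_eq_square field_simps del: inner_gt_zero_iff)
  qed
  then have "A *v v = c *\<^sub>R v"
    by (simp add: r_def)
  moreover have "v \<noteq> 0" using v by auto
  ultimately have "c \<in> eigenvalues A"
    by (auto simp: eigenvalues_def)
  then show ?thesis
    using bound that by blast
qed

text \<open>Eigenvectors chosen for distinct eigenvalues of a symmetric matrix are orthogonal, hence
  independent. Finiteness makes \<open>Max\<close> and \<open>Min\<close> in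
  \<open>cond_number\<close> meaningful.\<close>

lemma finite_eigenvalues:
  fixes A :: "real^'n^'n"
  assumes A: "transpose A = A"
  shows "finite (eigenvalues A)"
proof -
  define f where "f c = (SOME v. v \<noteq> 0 \<and> A *v v = c *\<^sub>R v)" for c
  have f: "f c \<noteq> 0 \<and> A *v f c = c *\<^sub>R f c" if "c \<in> eigenvalues A" for c
    unfolding f_def by (rule someI_ex) (use that in \<open>simp add: eigenvalues_def\<close>)
  have inj: "inj_on f (eigenvalues A)"
    by (rule inj_onI) (metis f scaleR_right_imp_eq)
  have "orthogonal (f a) (f b)" if "a \<in> eigenvalues A" "b \<in> eigenvalues A" "a \<noteq> b" for a b
    using sym_inner_commute[OF A, of "f a" "f b"] f that by (auto simp: orthogonal_def inner_commute)
  then have "pairwise orthogonal (f ` eigenvalues A)"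
    by (auto simp: pairwise_def)
  moreover have "0 \<notin> f ` eigenvalues A"
    using f by auto
  ultimately have "finite (f ` eigenvalues A)"
    using pairwise_orthogonal_independent independent_imp_finite by blast
  then show ?thesis
    using inj by (rule finite_imageD)
qed

lemma Max_eigenvalues_bound:
  fixes A :: "real^'n^'n"
  assumes "transpose A = A"
  shows "x \<bullet> (A *v x) \<le> Max (eigenvalues A) * (x \<bullet> x)"
proof -
  obtain c where c: "c \<in> eigenvalues A" "\<And>x. x \<bullet> (A *v x) \<le> c * (x \<bullet> x)"
    using rayleigh_max_eigenvalue[OF assms] by blast
  have "c \<le> Max (eigenvalues A)"
    using c finite_eigenvalues[OF assms] by simp
  then show ?thesis
    by (meson c(2) inner_ge_zero mult_right_mono order_trans)
qed

text \<open>The Rayleigh bound for \<open>- A\<close>, whose eigenvalues are the negatives of those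
  of \<open>A\<close>.\<close>

lemma Min_eigenvalues_bound:
  fixes A :: "real^'n^'n"
  assumes "transpose A = A"
  shows "Min (eigenvalues A) * (x \<bullet> x) \<le> x \<bullet> (A *v x)"
proof -
  have minus: "(- A) *v v = - (A *v v)" for v
    by (simp add: vec_eq_iff matrix_vector_mult_def sum_negf)
  have "transpose (- A) = - A"
    using assms by (simp add: transpose_def vec_eq_iff)
  from rayleigh_max_eigenvalue[OF this]
  obtain c where c: "c \<in> eigenvalues (- A)" "\<And>x. x \<bullet> ((- A) *v x) \<le> c * (x \<bullet> x)"
    by blast
  from c(1) have "- c \<in> eigenvalues A"
    by (auto simp: eigenvalues_def minus) (metis add.inverse_inverse)
  then have "Min (eigenvalues A) \<le> - c"
    using finite_eigenvalues[OF assms] by simp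
  then have "Min (eigenvalues A) * (x \<bullet> x) \<le> - c * (x \<bullet> x)"
    by (rule mult_right_mono) simp
  then show ?thesis
    using c(2)[of x] by (simp add: minus)
qed

lemma Min_Max_eigenvalues_pos:
  fixes A :: "real^'n^'n"
  assumes "pos_def A"
  shows "Min (eigenvalues A) > 0" "Max (eigenvalues A) > 0"
proof -
  have A: "transpose A = A" using assms by (simp add: pos_def_def)
  have ne: "eigenvalues A \<noteq> {}"
    using rayleigh_max_eigenvalue[OF A] by blast
  have pos: "c > 0" if c: "c \<in> eigenvalues A" for c
  proof -
    from c obtain v where v: "v \<noteq> 0" "A *v v = c *\<^sub>R v" by (auto simp: eigenvalues_def)
    then have "c * (v \<bullet> v) > 0" using assms by (metis inner_scaleR_right pos_def_def)
    then show ?thesis using inner_ge_zero[of v] by (simp add: zero_less_mult_iff del: inner_ge_zero)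
  qed
  show "Min (eigenvalues A) > 0" "Max (eigenvalues A) > 0"
    using pos ne finite_eigenvalues[OF A] by (simp_all add: Max_in)
qed

section \<open>Derivatives of the log-determinant\<close>

text \<open>By the Leibniz formula the determinant is a polynomial in the entries.\<close>

lemma det_differentiable:
  fixes F :: "'a::real_normed_vector \<Rightarrow> real^'n^'n"
  assumes "\<And>i j. (\<lambda>x. F x $ i $ j) differentiable (at x)"
  shows "(\<lambda>x. det (F x)) differentiable (at x)"
proof -
  obtain F' where F': "\<And>i j. ((\<lambda>x. F x $ i $ j) has_derivative F' i j) (at x)"
    using assms unfolding differentiable_def by metis
  show ?thesis
    unfolding det_def differentiable_def
    by (rule exI, (rule derivative_intros F')+)
qed

lemma has_derivative_matrix_nth:
  "((\<lambda>A::real^'n^'m. A $ i $ j) has_derivative (\<lambda>E. E $ i $ j)) F"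
  by (intro bounded_linear_imp_has_derivative bounded_linear_compose[OF bounded_linear_vec_nth]
      bounded_linear_vec_nth)

text \<open>Only the identity permutation survives in the differentiated Leibniz sum: any other one
  moves at least two indices, so an off-diagonal zero remains after one factor has been
  replaced.\<close>

lemma has_derivative_det_mat_1:
  "((det :: real^'n^'n \<Rightarrow> real) has_derivative trace) (at (mat 1))"
proof -
  let ?P = "{p. p permutes (UNIV :: 'n set)}"
  have "((\<lambda>A::real^'n^'n. \<Sum>p\<in>?P. of_int (sign p) * (\<Prod>i\<in>UNIV. A $ i $ p i)) has_derivative
      (\<lambda>E. \<Sum>p\<in>?P. of_int (sign p) * (\<Sum>i\<in>UNIV. E $ i $ p i * (\<Prod>j\<in>UNIV - {i}. mat 1 $ j $ p j)))) (at (mat 1))"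
    by (intro has_derivative_sum has_derivative_mult_right has_derivative_prod has_derivative_matrix_nth)
  moreover have "(\<lambda>E::real^'n^'n. \<Sum>p\<in>?P. of_int (sign p) *
      (\<Sum>i\<in>UNIV. E $ i $ p i * (\<Prod>j\<in>UNIV - {i}. mat 1 $ j $ p j))) = trace"
  proof
    fix E :: "real^'n^'n"
    have zero: "(\<Prod>j\<in>UNIV - {i}. (mat 1 :: real^'n^'n) $ j $ p j) = 0" if p: "p permutes UNIV" "p \<noteq> id" for p and i :: 'n
    proof -
      \<comment> \<open>The two moved indices are \<open>k\<close> and \<open>p k\<close>; at most
        one of them is the omitted \<open>i\<close>.\<close>
      obtain k where k: "p k \<noteq> k" using p by (auto simp: fun_eq_iff)
      then have pk: "p (p k) \<noteq> p k"
        using p(1) by (metis permutes_univ)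
      have "\<exists>j\<in>UNIV - {i}. (mat 1 :: real^'n^'n) $ j $ p j = 0"
      proof (cases "k = i")
        case True
        then show ?thesis using k pk by (intro bexI[of _ "p k"]) (auto simp: mat_def)
      next
        case False
        then show ?thesis using k by (intro bexI[of _ k]) (auto simp: mat_def)
      qed
      then show ?thesis by (intro prod_zero) auto
    qed
    have "(\<Sum>p\<in>?P. of_int (sign p) * (\<Sum>i\<in>UNIV. E $ i $ p i * (\<Prod>j\<in>UNIV - {i}. mat 1 $ j $ p j))) =
        (\<Sum>p\<in>{id}. of_int (sign p) * (\<Sum>i\<in>UNIV. E $ i $ p i * (\<Prod>j\<in>UNIV - {i}. (mat 1 :: real^'n^'n) $ j $ p j)))"
      by (rule sum.mono_neutral_right) (auto simp: permutes_id zero)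
    also have "\<dots> = trace E"
      by (simp add: trace_def mat_def sign_id)
    finally show "(\<Sum>p\<in>?P. of_int (sign p) *
      (\<Sum>i\<in>UNIV. E $ i $ p i * (\<Prod>j\<in>UNIV - {i}. mat 1 $ j $ p j))) = trace E" .
  qed
  ultimately show ?thesis
    by (simp add: det_def[abs_def])
qed

lemma bounded_bilinear_matrix_mult:
  "bounded_bilinear ((**) :: real^'n^'m \<Rightarrow> real^'k^'n \<Rightarrow> real^'k^'m)"
  unfolding bilinear_conv_bounded_bilinear[symmetric] bilinear_def
  by (auto intro!: linearI simp: vec_eq_iff matrix_matrix_mult_def sum.distrib algebra_simps sum_distrib_left)

lemma matrix_inv_invertible:
  fixes A :: "real^'n^'n"
  assumes "det A \<noteq> 0"
  shows "A ** matrix_inv A = mat 1" "matrix_inv A ** A = mat 1"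
proof -
  obtain B where "A ** B = mat 1"
    using assms by (auto simp: invertible_det_nz[symmetric] invertible_def)
  then show "A ** matrix_inv A = mat 1"
    by (simp add: matrix_inv_eqI)
  then show "matrix_inv A ** A = mat 1"
    by (rule matrix_left_right_inverse[THEN iffD1])
qed

text \<open>Jacobi's formula: \<open>det B = det A * det (A^-1 B)\<close> moves the base point to
  the identity.\<close>

lemma has_derivative_det:
  fixes A :: "real^'n^'n"
  assumes "det A \<noteq> 0"
  shows "(det has_derivative (\<lambda>E. det A * trace (matrix_inv A ** E))) (at A)"
proof -
  have "((\<lambda>B. matrix_inv A ** B) has_derivative (\<lambda>E. matrix_inv A ** E)) (at A)"
    by (rule bounded_linear_imp_has_derivative)
      (rule bounded_bilinear.bounded_linear_right[OF bounded_bilinear_matrix_mult])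
  moreover have "((det :: real^'n^'n \<Rightarrow> real) has_derivative trace) (at (matrix_inv A ** A))"
    by (simp add: matrix_inv_invertible(2)[OF assms] has_derivative_det_mat_1)
  ultimately have "((\<lambda>B. det (matrix_inv A ** B)) has_derivative (\<lambda>E. trace (matrix_inv A ** E))) (at A)"
    by (rule has_derivative_compose)
  then have "((\<lambda>B. det A * det (matrix_inv A ** B)) has_derivative (\<lambda>E. det A * trace (matrix_inv A ** E))) (at A)"
    by (rule has_derivative_mult_right)
  moreover have "det A * det (matrix_inv A ** B) = det B" for B
    by (simp add: det_mul[symmetric] matrix_mul_assoc matrix_inv_invertible(1)[OF assms])
  ultimately show ?thesis by simp
qed

text \<open>Column \<open>l\<close> of the inverse solves \<open>A x = e_l\<close>, so Cramer's rule
  applies. It exhibits the entries as rational functions, hence differentiable.\<close>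

lemma matrix_inv_cramer:
  fixes A :: "real^'n^'n"
  assumes "det A \<noteq> 0"
  shows "matrix_inv A $ k $ l = det (\<chi> i j. if j = k then axis l 1 $ i else A $ i $ j) / det A"
proof -
  have "A *v (matrix_inv A *v axis l 1) = axis l 1"
    by (simp add: matrix_vector_mul_assoc matrix_inv_invertible(1)[OF assms])
  then have "matrix_inv A *v axis l 1 = (\<chi> k. det (\<chi> i j. if j = k then axis l 1 $ i else A $ i $ j) / det A)"
    by (rule cramer[OF assms, THEN iffD1])
  then show ?thesis
    by (simp add: matrix_vector_mult_basis column_def vec_eq_iff)
qed

lemma open_det_nonzero: "open {A::real^'n^'n. det A \<noteq> 0}"
proof -
  have "continuous_on UNIV (det :: real^'n^'n \<Rightarrow> real)"
    by (intro continuous_at_imp_continuous_on ballI differentiable_imp_continuous_within det_differentiable)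
      (auto simp: differentiable_def intro: has_derivative_matrix_nth)
  then have "open (det -` (- {0}) :: (real^'n^'n) set)"
    by (intro open_vimage) auto
  then show ?thesis by (simp add: vimage_def)
qed

text \<open>\<open>matrix_inv\<close> coincides with Cramer's quotient \<open>G\<close> on the open
  set of nonzero determinant, which is enough for a derivative at \<open>A\<close>.\<close>

lemma matrix_inv_differentiable:
  fixes A :: "real^'n^'n"
  assumes "det A \<noteq> 0"
  shows "matrix_inv differentiable (at A)"
proof -
  define G :: "real^'n^'n \<Rightarrow> real^'n^'n" where
    "G B = (\<chi> k l. det (\<chi> i j. if j = k then axis l 1 $ i else B $ i $ j) / det B)" for B
  have nth: "(\<lambda>B::real^'n^'n. B $ i $ j) differentiable (at A)" for i j
    by (auto simp: differentiable_def intro: has_derivative_matrix_nth)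
  have "(\<lambda>B. G B $ k $ l) differentiable (at A)" for k l
  proof -
    have "(\<lambda>B. if j = k then axis l 1 $ i else B $ i $ j) differentiable (at A)" for i j
      using nth by (cases "j = k") auto
    then have d: "(\<lambda>B. det (\<chi> i j. if j = k then axis l 1 $ i else B $ i $ j)) differentiable (at A)"
      by (intro det_differentiable) simp
    then show ?thesis
      using differentiable_divide[OF d det_differentiable[OF nth] assms] by (simp add: G_def)
  qed
  then have "G differentiable (at A)"
    by (subst differentiable_componentwise_within)
      (auto simp: Basis_vec_def inner_axis axis_eq_axis)
  then obtain G' where "(G has_derivative G') (at A)"
    by (auto simp: differentiable_def)
  then have "(matrix_inv has_derivative G') (at A)"
    by (rule has_derivative_transform_within_open[OF _ open_det_nonzero])
      (auto simp: assms G_def matrix_inv_cramer vec_eq_iff)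
  then show ?thesis by (rule differentiableI)
qed

text \<open>Once a derivative exists, differentiating \<open>B B^-1 = I\<close> by the product rule
  determines it.\<close>

lemma has_derivative_matrix_inv:
  fixes A :: "real^'n^'n"
  assumes "det A \<noteq> 0"
  shows "(matrix_inv has_derivative (\<lambda>E. - (matrix_inv A ** E ** matrix_inv A))) (at A)"
proof -
  obtain G where G: "(matrix_inv has_derivative G) (at A)"
    using matrix_inv_differentiable[OF assms] by (auto simp: differentiable_def)
  have "((\<lambda>B. B ** matrix_inv B) has_derivative (\<lambda>E. A ** G E + E ** matrix_inv A)) (at A)"
    by (rule bounded_bilinear.FDERIV[OF bounded_bilinear_matrix_mult has_derivative_ident G])
  moreover have "((\<lambda>B. B ** matrix_inv B) has_derivative (\<lambda>E. 0)) (at A)"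
    by (rule has_derivative_transform_within_open[OF has_derivative_const[of "mat 1"] open_det_nonzero])
      (auto simp: assms matrix_inv_invertible)
  ultimately have eq: "(\<lambda>E. A ** G E + E ** matrix_inv A) = (\<lambda>E. 0)"
    by (rule has_derivative_unique)
  have "G E = - (matrix_inv A ** E ** matrix_inv A)" for E
  proof -
    have "A ** G E = - (E ** matrix_inv A)"
      using fun_cong[OF eq, of E] by (simp add: eq_neg_iff_add_eq_0)
    then have "matrix_inv A ** (A ** G E) = - (matrix_inv A ** (E ** matrix_inv A))"
      by (simp add: bounded_bilinear.minus_right[OF bounded_bilinear_matrix_mult])
    then show ?thesis
      by (simp add: matrix_mul_assoc matrix_inv_invertible(2)[OF assms])
  qed
  then have "G = (\<lambda>E. - (matrix_inv A ** E ** matrix_inv A))" by auto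
  with G show ?thesis by simp
qed

lemma bounded_linear_trace: "bounded_linear (trace :: real^'n^'n \<Rightarrow> real)"
  by (simp add: linear_conv_bounded_linear[symmetric] linear_iff trace_add)
    (simp add: trace_def sum_distrib_left)

section \<open>Gradient and Hessian of \<open>-ln det\<close> along a linear map\<close>

lemma gradient_eqI: "GDERIV f x :> D \<Longrightarrow> gradient f x = D"
  unfolding gradient_def
proof (rule the_equality)
  fix D' assume "GDERIV f x :> D" "GDERIV f x :> D'"
  then have "(\<lambda>h. h \<bullet> D) = (\<lambda>h. h \<bullet> D')"
    unfolding gderiv_def by (rule has_derivative_unique)
  then show "D' = D"
    by (metis inner_commute vector_eq_rdot)
qed

text \<open>Riesz representation in coordinates, used to turn derivatives into gradient
  vectors.\<close>

lemma linear_functional_coords: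
  fixes f :: "real^'u \<Rightarrow> real"
  assumes "linear f"
  shows "f h = h \<bullet> (\<chi> j. f (axis j 1))"
proof -
  have "h = (\<Sum>j\<in>UNIV. h $ j *\<^sub>R axis j 1)"
    using basis_expansion[of h] by (simp add: scalar_mult_eq_scaleR)
  then have "f h = f (\<Sum>j\<in>UNIV. h $ j *\<^sub>R axis j 1)"
    by (rule arg_cong)
  then show ?thesis
    by (simp add: linear_sum[OF assms] linear_cmul[OF assms] inner_vec_def)
qed

text \<open>The factor \<open>det\<close> in Jacobi's formula cancels against the derivative of
  \<open>ln\<close>.\<close>

lemma log_det_gradient:
  fixes L :: "real^'u \<Rightarrow> real^'n^'n"
  assumes L: "linear L" and pos: "det (L x) > 0"
  shows "gradient (\<lambda>x. - ln (det (L x))) x = (\<chi> j. - trace (matrix_inv (L x) ** L (axis j 1)))"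
proof (rule gradient_eqI)
  have "(L has_derivative L) (at x)"
    using L by (simp add: linear_conv_bounded_linear bounded_linear_imp_has_derivative)
  then have "((\<lambda>x. det (L x)) has_derivative (\<lambda>h. det (L x) * trace (matrix_inv (L x) ** L h))) (at x)"
    by (rule has_derivative_compose) (use pos in \<open>auto intro: has_derivative_det\<close>)
  from has_derivative_minus[OF has_derivative_ln[OF pos this]]
  have der: "((\<lambda>x. - ln (det (L x))) has_derivative (\<lambda>h. - trace (matrix_inv (L x) ** L h))) (at x)"
    using pos by (simp add: mult.commute[of "det (L x)"] mult.assoc)
  have "linear (\<lambda>h. - trace (matrix_inv (L x) ** L h))"
    using has_derivative_linear[OF der] .
  then have "(\<lambda>h. - trace (matrix_inv (L x) ** L h)) = (\<lambda>h. h \<bullet> (\<chi> j. - trace (matrix_inv (L x) ** L (axis j 1))))"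
    by (intro ext) (rule linear_functional_coords)
  with der show "GDERIV (\<lambda>x. - ln (det (L x))) x :> (\<chi> j. - trace (matrix_inv (L x) ** L (axis j 1)))"
    unfolding gderiv_def by (simp only:)
qed

text \<open>Differentiate the gradient formula once more, with the derivative of the matrix inverse;
  the two minus signs cancel.\<close>

lemma log_det_hessian:
  fixes L :: "real^'u \<Rightarrow> real^'n^'n"
  assumes L: "linear L" and pos: "det (L x) > 0"
  shows "v \<bullet> (hessian (\<lambda>x. - ln (det (L x))) x *v u) =
    trace (matrix_inv (L x) ** L u ** matrix_inv (L x) ** L v)"
proof -
  let ?f = "\<lambda>x. - ln (det (L x))"
  have bL: "bounded_linear L" using L by (simp add: linear_conv_bounded_linear)
  have "((\<lambda>x. matrix_inv (L x)) has_derivative (\<lambda>h. - (matrix_inv (L x) ** L h ** matrix_inv (L x)))) (at x)"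
    by (rule has_derivative_compose[OF bounded_linear_imp_has_derivative[OF bL]])
      (use pos in \<open>auto intro: has_derivative_matrix_inv\<close>)
  then have "((\<lambda>x. - trace (matrix_inv (L x) ** L (axis j 1))) has_derivative
      (\<lambda>h. - trace (- (matrix_inv (L x) ** L h ** matrix_inv (L x)) ** L (axis j 1)))) (at x)" for j
    by (intro has_derivative_minus bounded_linear.has_derivative[OF bounded_linear_trace]
        bounded_linear.has_derivative[OF bounded_bilinear.bounded_linear_left[OF bounded_bilinear_matrix_mult]])
  then have "((\<lambda>x. \<chi> j. - trace (matrix_inv (L x) ** L (axis j 1))) has_derivative
      (\<lambda>h. \<chi> j. - trace (- (matrix_inv (L x) ** L h ** matrix_inv (L x)) ** L (axis j 1)))) (at x)"
    by (subst has_derivative_componentwise_within) (auto simp: Basis_vec_def inner_axis)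
  \<comment> \<open>The gradient formula is available where the determinant is positive; openness of
    this region carries the derivative over to \<open>gradient\<close>.\<close>
  moreover have "open {x. det (L x) > 0}"
  proof -
    have "continuous_on UNIV L" using bL by (rule linear_continuous_on)
    moreover have "continuous_on UNIV (det :: real^'n^'n \<Rightarrow> real)"
      by (intro continuous_at_imp_continuous_on ballI differentiable_imp_continuous_within det_differentiable)
        (auto simp: differentiable_def intro: has_derivative_matrix_nth)
    ultimately have "continuous_on UNIV (\<lambda>x. det (L x))"
      using continuous_on_compose2 by blast
    then have "open ((\<lambda>x. det (L x)) -` {0<..})"
      by (intro open_vimage) auto
    then show ?thesis by (simp add: vimage_def)
  qed
  ultimately have der: "(gradient ?f has_derivative
      (\<lambda>h. \<chi> j. - trace (- (matrix_inv (L x) ** L h ** matrix_inv (L x)) ** L (axis j 1)))) (at x)"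
    by (rule has_derivative_transform_within_open) (auto simp: pos log_det_gradient[OF L])
  then have "(gradient ?f has_derivative (\<lambda>h. hessian ?f x *v h)) (at x)"
    unfolding hessian_def using jacobian_works differentiableI by blast
  from has_derivative_unique[OF this der]
  have H: "hessian ?f x *v u = (\<chi> j. - trace (- (matrix_inv (L x) ** L u ** matrix_inv (L x)) ** L (axis j 1)))"
    by meson
  have lin: "linear (\<lambda>v. - trace (- (matrix_inv (L x) ** L u ** matrix_inv (L x)) ** L v))"
    by (intro bounded_linear.linear bounded_linear_minus bounded_linear_compose[OF bounded_linear_trace]
        bounded_linear_compose[OF bounded_bilinear.bounded_linear_right[OF bounded_bilinear_matrix_mult] bL])
  have "v \<bullet> (hessian ?f x *v u) = - trace (- (matrix_inv (L x) ** L u ** matrix_inv (L x)) ** L v)"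
    unfolding H by (rule linear_functional_coords[OF lin, symmetric])
  also have "\<dots> = trace (matrix_inv (L x) ** L u ** matrix_inv (L x) ** L v)"
    by (simp add: bounded_bilinear.minus_left[OF bounded_bilinear_matrix_mult]
        linear_neg[OF bounded_linear.linear[OF bounded_linear_trace]])
  finally show ?thesis .
qed

section \<open>Evaluation of polynomials\<close>

definition monomial_eval :: "('n::finite \<Rightarrow>\<^sub>0 nat) \<Rightarrow> real^'n \<Rightarrow> real" where
  "monomial_eval e z = (\<Prod>i\<in>UNIV. (z $ i) ^ Poly_Mapping.lookup e i)"

lemma monomial_eval_add: "monomial_eval (e + f) z = monomial_eval e z * monomial_eval f z"
  by (simp add: monomial_eval_def lookup_add power_add prod.distrib)

text \<open>Summing over any finite superset of the support lets polynomials with different supports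
  share one index set.\<close>

lemma mpoly_eval_superset:
  assumes "finite K" "Poly_Mapping.keys r \<subseteq> K"
  shows "mpoly_eval r z = (\<Sum>e\<in>K. Poly_Mapping.lookup r e * monomial_eval e z)"
  unfolding mpoly_eval_def monomial_eval_def
  using assms by (intro sum.mono_neutral_left) (auto simp: in_keys_iff)

lemma mpoly_eval_0 [simp]: "mpoly_eval 0 z = 0"
  by (simp add: mpoly_eval_def)

lemma mpoly_eval_add: "mpoly_eval (r + r') z = mpoly_eval r z + mpoly_eval r' z"
proof -
  let ?K = "Poly_Mapping.keys r \<union> Poly_Mapping.keys r'"
  show ?thesis
    using mpoly_eval_superset[of ?K "r + r'" z] mpoly_eval_superset[of ?K r z] mpoly_eval_superset[of ?K r' z]
      Poly_Mapping.keys_add[of r r']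
    by (simp add: lookup_add distrib_right sum.distrib)
qed

lemma lookup_scaleR: "Poly_Mapping.lookup (c *\<^sub>R r) e = c *\<^sub>R Poly_Mapping.lookup r e"
proof -
  have "finite {e. c *\<^sub>R Poly_Mapping.lookup r e \<noteq> 0}"
    by (rule finite_subset[OF _ finite_keys[of r]]) (auto simp: in_keys_iff)
  then show ?thesis
    by (simp add: scaleR_poly_mapping_def Abs_poly_mapping_inverse)
qed

lemma mpoly_eval_scaleR: "mpoly_eval (c *\<^sub>R r) z = c * mpoly_eval r z"
proof -
  have "Poly_Mapping.keys (c *\<^sub>R r) \<subseteq> Poly_Mapping.keys r"
    by (auto simp: in_keys_iff lookup_scaleR)
  then show ?thesis
    using mpoly_eval_superset[of "Poly_Mapping.keys r" "c *\<^sub>R r" z] mpoly_eval_superset[of "Poly_Mapping.keys r" r z]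
    by (simp add: lookup_scaleR sum_distrib_left mult.assoc)
qed

lemma mpoly_eval_sum: "mpoly_eval (\<Sum>k\<in>K. r k) z = (\<Sum>k\<in>K. mpoly_eval (r k) z)"
  by (induction K rule: infinite_finite_induct) (simp_all add: mpoly_eval_add)

lemma mpoly_eval_sum_list: "mpoly_eval (\<Sum>r\<leftarrow>rs. g r) z = (\<Sum>r\<leftarrow>rs. mpoly_eval (g r) z)"
  by (induction rs) (simp_all add: mpoly_eval_add)

lemma mpoly_eval_single: "mpoly_eval (Poly_Mapping.single e c) z = c * monomial_eval e z"
  using mpoly_eval_superset[of "{e}" "Poly_Mapping.single e c" z] by (simp add: keys_single)

lemma poly_mapping_eq_sum_singles: "r = (\<Sum>e\<in>Poly_Mapping.keys r. Poly_Mapping.single e (Poly_Mapping.lookup r e))"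
  by (rule poly_mapping_eqI)
    (auto simp: lookup_sum lookup_single when_def in_keys_iff)

text \<open>Expand both factors into monomials; evaluation turns addition of exponents into
  multiplication.\<close>

lemma mpoly_eval_mult: "mpoly_eval (r * r') z = mpoly_eval r z * mpoly_eval r' z"
proof -
  let ?K = "Poly_Mapping.keys r" and ?K' = "Poly_Mapping.keys r'"
  have "r * r' = (\<Sum>e\<in>?K. \<Sum>f\<in>?K'. Poly_Mapping.single (e + f) (Poly_Mapping.lookup r e * Poly_Mapping.lookup r' f))"
    by (subst poly_mapping_eq_sum_singles[of r], subst poly_mapping_eq_sum_singles[of r'])
      (simp add: sum_product mult_single)
  then have "mpoly_eval (r * r') z = (\<Sum>e\<in>?K. \<Sum>f\<in>?K'.
      (Poly_Mapping.lookup r e * monomial_eval e z) * (Poly_Mapping.lookup r' f * monomial_eval f z))"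
    by (simp add: mpoly_eval_sum mpoly_eval_single monomial_eval_add mult_ac)
  also have "\<dots> = mpoly_eval r z * mpoly_eval r' z"
    by (simp add: sum_product[symmetric] mpoly_eval_superset[of ?K r] mpoly_eval_superset[of ?K' r'])
  finally show ?thesis .
qed

lemma mpoly_eval_power2: "mpoly_eval (r\<^sup>2) z = (mpoly_eval r z)\<^sup>2"
  by (simp add: power2_eq_square mpoly_eval_mult)

lemma polys_le_0: "0 \<in> polys_le k"
  by (simp add: polys_le_def)

lemma polys_le_mult:
  assumes "r \<in> polys_le k" "r' \<in> polys_le k'"
  shows "r * r' \<in> polys_le (k + k')"
  unfolding polys_le_def
proof safe
  fix e assume "e \<in> Poly_Mapping.keys (r * r')"
  then obtain a b where "e = a + b" "a \<in> Poly_Mapping.keys r" "b \<in> Poly_Mapping.keys r'"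
    using keys_mult[of r r'] by blast
  then show "(\<Sum>i\<in>UNIV. Poly_Mapping.lookup e i) \<le> k + k'"
    using assms by (auto simp: polys_le_def lookup_add sum.distrib intro!: add_mono)
qed

section \<open>A point at which two given nonzero polynomials do not vanish\<close>

text \<open>Compare the lowest digits modulo \<open>B\<close>, then divide by \<open>B\<close> and
  use induction. It makes the Kronecker encoding of exponent vectors injective.\<close>

lemma digits_unique:
  fixes B :: nat
  assumes "(\<Sum>i<n. a i * B ^ i) = (\<Sum>i<n. b i * B ^ i)" "\<And>i. i < n \<Longrightarrow> a i < B" "\<And>i. i < n \<Longrightarrow> b i < B" "i < n"
  shows "a i = b i"
  using assms
proof (induction n arbitrary: a b i)
  case (Suc n)
  have split: "(\<Sum>i<Suc n. c i * B ^ i) = c 0 + B * (\<Sum>i<n. c (Suc i) * B ^ i)" for c :: "nat \<Rightarrow> nat"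
    by (simp add: sum.lessThan_Suc_shift sum_distrib_left mult_ac del: sum.lessThan_Suc)
  have eq: "a 0 + B * (\<Sum>i<n. a (Suc i) * B ^ i) = b 0 + B * (\<Sum>i<n. b (Suc i) * B ^ i)"
    using Suc.prems(1) by (simp only: split)
  have lt: "a 0 < B" "b 0 < B" using Suc.prems by auto
  have "a 0 = b 0"
    using arg_cong[OF eq, of "\<lambda>x. x mod B"] lt by simp
  with eq lt have "(\<Sum>i<n. a (Suc i) * B ^ i) = (\<Sum>i<n. b (Suc i) * B ^ i)"
    by simp
  then have "a (Suc j) = b (Suc j)" if "j < n" for j
    using Suc.IH[of "\<lambda>i. a (Suc i)" "\<lambda>i. b (Suc i)" j] Suc.prems that by simp
  with \<open>a 0 = b 0\<close> Suc.prems(4) show ?case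
    by (cases i) auto
qed simp

text \<open>
  Kronecker substitution \<open>z\<^sub>i = t\<^bsup>B^h(i)\<^esup>\<close>: for \<open>B\<close> larger than all exponents of \<open>r\<close>, different
  monomials of \<open>r\<close> become different powers of \<open>t\<close>.
\<close>
lemma kronecker_substitution:
  fixes r :: "'n::finite mpoly" and h :: "'n \<Rightarrow> nat"
  assumes h: "bij_betw h UNIV {..<n}" and r: "r \<noteq> 0"
    and B: "\<And>e i. e \<in> Poly_Mapping.keys r \<Longrightarrow> Poly_Mapping.lookup e i < B"
  obtains P :: "real poly" where "P \<noteq> 0" "\<And>t. poly P t = mpoly_eval r (\<chi> i. t ^ (B ^ h i))"
proof -
  define code where "code e = (\<Sum>i\<in>UNIV. Poly_Mapping.lookup e i * B ^ h i)" for e :: "'n \<Rightarrow>\<^sub>0 nat"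
  define P where "P = (\<Sum>e\<in>Poly_Mapping.keys r. monom (Poly_Mapping.lookup r e) (code e))"
  have inj: "e = f" if "e \<in> Poly_Mapping.keys r" "f \<in> Poly_Mapping.keys r" "code e = code f" for e f
  proof -
    define g where "g = inv_into UNIV h"
    have code: "code e = (\<Sum>j<n. Poly_Mapping.lookup e (g j) * B ^ j)" for e
      unfolding code_def
      by (rule sum.reindex_bij_witness[of _ g h])
        (use h in \<open>auto simp: g_def bij_betw_def inv_into_f_f f_inv_into_f\<close>)
    have "Poly_Mapping.lookup e (g j) = Poly_Mapping.lookup f (g j)" if "j < n" for j
      by (rule digits_unique[of "\<lambda>j. Poly_Mapping.lookup e (g j)" B n "\<lambda>j. Poly_Mapping.lookup f (g j)" j])
        (use \<open>code e = code f\<close> B \<open>e \<in> _\<close> \<open>f \<in> _\<close> that in \<open>simp_all add: code\<close>)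
    moreover have "g (h i) = i" "h i < n" for i
      using h by (auto simp: g_def bij_betw_def)
    ultimately have "Poly_Mapping.lookup e i = Poly_Mapping.lookup f i" for i
      by metis
    then show ?thesis by (rule poly_mapping_eqI)
  qed
  obtain e where e: "e \<in> Poly_Mapping.keys r"
    using r by fastforce
  \<comment> \<open>By injectivity of \<open>code\<close> on the support no other monomial lands on
    this power, so nothing cancels.\<close>
  have "coeff P (code e) = (\<Sum>f\<in>Poly_Mapping.keys r. if f = e then Poly_Mapping.lookup r f else 0)"
    unfolding P_def coeff_sum by (intro sum.cong) (use inj e in auto)
  then have "coeff P (code e) \<noteq> 0"
    using e by (simp add: in_keys_iff)
  then have "P \<noteq> 0" by auto
  moreover have "poly P t = mpoly_eval r (\<chi> i. t ^ (B ^ h i))" for t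
    by (simp add: P_def poly_sum poly_monom mpoly_eval_def code_def power_sum power_mult[symmetric] mult.commute)
  ultimately show ?thesis by (rule that)
qed

text \<open>One Kronecker substitution turns both polynomials into nonzero univariate ones; their
  product is a nonzero polynomial and so does not vanish at some real number.\<close>

lemma mpoly_eval_mult_nonzero:
  fixes r r' :: "'n::finite mpoly"
  assumes "r \<noteq> 0" "r' \<noteq> 0"
  obtains z where "mpoly_eval r z * mpoly_eval r' z \<noteq> 0"
proof -
  let ?K = "Poly_Mapping.keys r \<union> Poly_Mapping.keys r'"
  obtain h :: "'n \<Rightarrow> nat" where h: "bij_betw h UNIV {..<CARD('n)}"
    using ex_bij_betw_finite_nat[of "UNIV :: 'n set"] by (auto simp: atLeast0LessThan)
  \<comment> \<open>Larger than every exponent of either polynomial, so that the same substitution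
    serves both.\<close>
  define B where "B = Suc (\<Sum>e\<in>?K. \<Sum>i\<in>UNIV. Poly_Mapping.lookup e i)"
  have B: "Poly_Mapping.lookup e i < B" if "e \<in> ?K" for e i
  proof -
    have "Poly_Mapping.lookup e i \<le> (\<Sum>i\<in>UNIV. Poly_Mapping.lookup e i)"
      by (rule member_le_sum) auto
    also have "\<dots> \<le> (\<Sum>e\<in>?K. \<Sum>i\<in>UNIV. Poly_Mapping.lookup e i)"
      by (rule member_le_sum[of _ _ "\<lambda>e. \<Sum>i\<in>UNIV. Poly_Mapping.lookup e i"]) (use that in auto)
    finally show ?thesis by (simp add: B_def)
  qed
  obtain P where P: "P \<noteq> 0" "\<And>t. poly P t = mpoly_eval r (\<chi> i. t ^ (B ^ h i))"
    using kronecker_substitution[OF h assms(1), of B] B by blast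
  obtain P' where P': "P' \<noteq> 0" "\<And>t. poly P' t = mpoly_eval r' (\<chi> i. t ^ (B ^ h i))"
    using kronecker_substitution[OF h assms(2), of B] B by blast
  have "P * P' \<noteq> 0" using P P' by simp
  then obtain t where "poly (P * P') t \<noteq> 0"
    using poly_all_0_iff_0 by blast
  then show ?thesis
    using that P P' by (metis poly_mult)
qed

section \<open>The matrix pencil of a weighted sums-of-squares cone\<close>

lemma linear_from_coords: "linear (from_coords q)"
  by (rule linearI) (simp_all add: from_coords_def scaleR_left_distrib sum.distrib scaleR_sum_right)

lemma range_from_coords: "range (from_coords q) = span (range q)" if "inj q"
proof -
  have "span (range q) = range (\<lambda>u. \<Sum>v\<in>range q. u v *\<^sub>R v)"
    by (simp add: span_finite)
  also have "\<dots> = range (from_coords q)"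
  proof safe
    fix u :: "'b \<Rightarrow> real"
    have "(\<Sum>v\<in>range q. u v *\<^sub>R v) = from_coords q (\<chi> j. u (q j))"
      using that by (simp add: from_coords_def sum.reindex)
    then show "(\<Sum>v\<in>range q. u v *\<^sub>R v) \<in> range (from_coords q)" by simp
  next
    fix x
    have "from_coords q x = (\<Sum>v\<in>range q. (x $ inv q v) *\<^sub>R v)"
      using that by (simp add: from_coords_def sum.reindex)
    then show "from_coords q x \<in> range (\<lambda>u. \<Sum>v\<in>range q. u v *\<^sub>R v)"
      by (intro image_eqI[of _ _ "\<lambda>v. x $ inv q v"]) auto
  qed
  finally show ?thesis ..
qed

lemma from_coords_eq_0_iff:
  assumes "inj q" "independent (range q)"
  shows "from_coords q x = 0 \<longleftrightarrow> x = 0"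
proof
  assume "from_coords q x = 0"
  then have "(\<Sum>v\<in>range q. (x $ inv q v) *\<^sub>R v) = 0"
    using assms(1) by (simp add: from_coords_def sum.reindex)
  then have "x $ inv q v = 0" if "v \<in> range q" for v
    using independentD[OF assms(2), of "range q" "\<lambda>v. x $ inv q v" v] that by simp
  then have "x $ j = 0" for j
    using assms(1) by (metis inv_f_f rangeI)
  then show "x = 0" by (simp add: vec_eq_iff)
qed (simp add: linear_0[OF linear_from_coords])

lemma mpoly_eval_from_coords: "mpoly_eval (from_coords q x) z = x \<bullet> eval_vec q z"
  by (simp add: from_coords_def mpoly_eval_sum mpoly_eval_scaleR inner_vec_def eval_vec_def)

text \<open>A unisolvent point set is part of the data because it makes the evaluation vectors span
  the coefficient space, on which the uniqueness of \<open>Lambda_block\<close> rests.\<close>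

locale weighted_sos_bases =
  fixes w :: "'m::finite \<Rightarrow> 'n::finite mpoly"
    and d :: "'m \<Rightarrow> nat"
    and q :: "'u::finite \<Rightarrow> 'n mpoly"
    and blk :: "'l::finite \<Rightarrow> 'm"
    and p :: "'l \<Rightarrow> 'n mpoly"
    and Z :: "(real^'n) set"
  assumes w_nonzero: "w i \<noteq> 0"
    and q_basis: "basis_family UNIV q (weighted_space w d)"
    and p_basis: "basis_family {a. blk a = i} p (polys_le (d i))"
    and Z_unisolvent: "unisolvent Z (weighted_space w d)"
begin

abbreviation \<Lambda> :: "real^'u \<Rightarrow> real^'l^'l" where
  "\<Lambda> \<equiv> Lambda q w blk p"

text \<open>Only values on \<open>weighted_space w d\<close>, the range of
  \<open>from_coords q\<close>, are meaningful.\<close>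

definition coords :: "'n mpoly \<Rightarrow> real^'u" where
  "coords = inv (from_coords q)"

lemma inj_q: "inj q" and indep_q: "independent (range q)" and span_q: "span (range q) = weighted_space w d"
  using q_basis by (auto simp: basis_family_def)

lemma from_coords_in_weighted_space: "from_coords q x \<in> weighted_space w d"
  using range_from_coords[OF inj_q] span_q by auto

lemma from_coords_coords: "r \<in> weighted_space w d \<Longrightarrow> from_coords q (coords r) = r"
  unfolding coords_def using range_from_coords[OF inj_q] span_q by (metis f_inv_into_f)

lemma coords_inner_eval_vec: "r \<in> weighted_space w d \<Longrightarrow> coords r \<bullet> eval_vec q z = mpoly_eval r z"
  by (metis from_coords_coords mpoly_eval_from_coords)

text \<open>\<open>x \<bullet> eval_vec q z\<close> is the value at \<open>z\<close> of the
  polynomial with coefficient vector \<open>x\<close>; by unisolvence only the zero polynomial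
  vanishes on \<open>Z\<close>.\<close>

lemma eval_vec_separates:
  assumes "\<And>z. z \<in> Z \<Longrightarrow> x \<bullet> eval_vec q z = 0"
  shows "x = 0"
proof -
  have "0 \<in> weighted_space w d"
    using span_q span_zero by metis
  moreover have "mpoly_eval (from_coords q x) z = mpoly_eval 0 z" if "z \<in> Z" for z
    by (simp add: mpoly_eval_from_coords assms that)
  ultimately have "from_coords q x = 0"
    using Z_unisolvent from_coords_in_weighted_space unfolding unisolvent_def by blast
  then show ?thesis
    using from_coords_eq_0_iff[OF inj_q indep_q] by simp
qed

text \<open>A nonzero vector orthogonal to a proper span would be a nonzero polynomial vanishing
  everywhere.\<close>

lemma span_eval_vec: "span (range (eval_vec q)) = UNIV"
proof (rule ccontr)
  assume "span (range (eval_vec q)) \<noteq> UNIV"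
  then obtain x where "x \<noteq> 0" "\<And>v. v \<in> span (range (eval_vec q)) \<Longrightarrow> x \<bullet> v = 0"
    using span_not_UNIV_orthogonal by metis
  then show False
    using eval_vec_separates[of x] by (simp add: span_base)
qed

text \<open>The evaluation vectors span, so identities that are linear in the coefficient vector
  reduce to identities at each point \<open>z\<close>.\<close>

lemma linear_eq_if_eq_eval_vec:
  assumes "linear f" "linear g" "\<And>z. f (eval_vec q z) = g (eval_vec q z)"
  shows "f = g"
proof
  fix x
  show "f x = g x"
    by (rule linear_eq_on_span[OF assms(1,2), of "range (eval_vec q)"]) (use assms(3) span_eval_vec in auto)
qed

lemma mult_in_weighted_space:
  assumes "r \<in> polys_le (2 * d i)"
  shows "w i * r \<in> weighted_space w d"
proof -
  have "w i * r = (\<Sum>j\<in>UNIV. w j * (if j = i then r else 0))"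
    by (simp add: if_distrib cong: if_cong)
  moreover have "\<forall>j. (if j = i then r else 0) \<in> polys_le (2 * d j)"
    using assms by (simp add: polys_le_0)
  ultimately show ?thesis
    unfolding weighted_space_def by (intro CollectI exI[of _ "\<lambda>j. if j = i then r else 0"] conjI)
qed

lemma p_in_polys_le: "p a \<in> polys_le (d (blk a))"
  using p_basis[of "blk a"] by (auto simp: basis_family_def intro: span_base)

text \<open>Justifies the definite description. Existence: entry \<open>(a, b)\<close> pairs with
  the coefficient vector of \<open>w i * (p a * p b)\<close>, which lies in the space because the
  degrees add up to at most \<open>2 * d i\<close>. Uniqueness: the evaluation vectors span.\<close>

lemma Lambda_block_spec:
  "linear (Lambda_block q w blk p i)"
  "Lambda_block q w blk p i (eval_vec q z) = mpoly_eval (w i) z *\<^sub>R outer (block_eval_vec blk p i z)"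
proof -
  define L :: "real^'u \<Rightarrow> real^'l^'l" where
    "L x = (\<chi> a b. if blk a = i \<and> blk b = i then coords (w i * (p a * p b)) \<bullet> x else 0)" for x
  have mem: "w i * (p a * p b) \<in> weighted_space w d" if "blk a = i" "blk b = i" for a b
    using mult_in_weighted_space[of "p a * p b" i] polys_le_mult[OF p_in_polys_le p_in_polys_le, of a b] that
    by (simp add: mult_2)
  let ?Q = "\<lambda>L. linear L \<and> (\<forall>z. L (eval_vec q z) = mpoly_eval (w i) z *\<^sub>R outer (block_eval_vec blk p i z))"
  have "linear L"
    by (rule linearI) (auto simp: L_def vec_eq_iff inner_add_right)
  moreover have "L (eval_vec q z) = mpoly_eval (w i) z *\<^sub>R outer (block_eval_vec blk p i z)" for z
    unfolding L_def vec_eq_iff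
    by (simp add: outer_component block_eval_vec_def coords_inner_eval_vec mem mpoly_eval_mult)
  ultimately have L: "?Q L" by blast
  have "?Q (THE L. ?Q L)"
  proof (rule theI[of ?Q, OF L])
    fix L' assume "?Q L'"
    with L show "L' = L"
      by (intro linear_eq_if_eq_eval_vec) auto
  qed
  then show "linear (Lambda_block q w blk p i)"
    "Lambda_block q w blk p i (eval_vec q z) = mpoly_eval (w i) z *\<^sub>R outer (block_eval_vec blk p i z)"
    unfolding Lambda_block_def by blast+
qed

lemma linear_Lambda: "linear \<Lambda>"
proof -
  have "linear (\<lambda>x. \<Sum>i\<in>UNIV. Lambda_block q w blk p i x)"
    by (rule linear_compose_sum) (simp add: Lambda_block_spec)
  then show ?thesis by (simp add: Lambda_def[abs_def])
qed

lemma Lambda_eval_vec: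
  "\<Lambda> (eval_vec q z) = (\<Sum>i\<in>UNIV. mpoly_eval (w i) z *\<^sub>R outer (block_eval_vec blk p i z))"
  by (simp add: Lambda_def Lambda_block_spec)

lemma transpose_Lambda: "transpose (\<Lambda> x) = \<Lambda> x"
proof -
  have lin: "linear (transpose :: real^'l^'l \<Rightarrow> real^'l^'l)"
    by (rule linearI) (simp_all add: transpose_def vec_eq_iff)
  have "(\<lambda>x. transpose (\<Lambda> x)) = \<Lambda>"
  proof (rule linear_eq_if_eq_eval_vec)
    show "linear (\<lambda>x. transpose (\<Lambda> x))"
      using linear_compose[OF linear_Lambda lin] by (simp add: o_def)
    show "transpose (\<Lambda> (eval_vec q z)) = \<Lambda> (eval_vec q z)" for z
      by (simp add: Lambda_eval_vec linear_sum[OF lin] linear_cmul[OF lin] transpose_outer)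
  qed (rule linear_Lambda)
  from fun_cong[OF this, of x] show ?thesis .
qed

section \<open>The quadratic form of \<open>\<Lambda>\<close> and the dual cone\<close>

text \<open>The polynomial \<open>p_i^T u\<close>. A vector \<open>u\<close> thus encodes one
  polynomial per block, and their weighted squares yield the quadratic form of
  \<open>\<Lambda>\<close>.\<close>

definition block_poly :: "real^'l \<Rightarrow> 'm \<Rightarrow> 'n mpoly" where
  "block_poly u i = (\<Sum>a | blk a = i. (u $ a) *\<^sub>R p a)"

lemma block_poly_in_polys_le: "block_poly u i \<in> polys_le (d i)"
proof -
  have "block_poly u i \<in> span (p ` {a. blk a = i})"
    unfolding block_poly_def by (intro span_sum span_scale span_base) auto
  then show ?thesis
    using p_basis[of i] by (simp add: basis_family_def)
qed

lemma mpoly_eval_block_poly: "mpoly_eval (block_poly u i) z = block_eval_vec blk p i z \<bullet> u"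
proof -
  have "block_eval_vec blk p i z \<bullet> u = (\<Sum>a\<in>UNIV. if blk a = i then u $ a * mpoly_eval (p a) z else 0)"
    by (auto simp: inner_vec_def block_eval_vec_def intro!: sum.cong)
  then show ?thesis
    by (simp add: block_poly_def mpoly_eval_sum mpoly_eval_scaleR sum.If_cases)
qed

text \<open>Padding with zeros outside block \<open>i\<close> isolates a single weighted
  square.\<close>

lemma block_poly_surj:
  assumes "r \<in> polys_le (d i)"
  obtains u where "block_poly u i = r" "\<And>j. j \<noteq> i \<Longrightarrow> block_poly u j = 0"
proof -
  let ?I = "{a. blk a = i}"
  have inj: "inj_on p ?I" and "r \<in> span (p ` ?I)"
    using p_basis[of i] assms by (auto simp: basis_family_def)
  then obtain c where c: "r = (\<Sum>v\<in>p ` ?I. c v *\<^sub>R v)"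
    by (auto simp: span_finite)
  define u :: "real^'l" where "u = (\<chi> a. if blk a = i then c (p a) else 0)"
  have "block_poly u i = r"
    by (simp add: c block_poly_def u_def sum.reindex[OF inj])
  moreover have "block_poly u j = 0" if "j \<noteq> i" for j
    unfolding block_poly_def u_def by (rule sum.neutral) (use that in auto)
  ultimately show ?thesis by (rule that)
qed

lemma block_poly_all_0:
  assumes "\<And>i. block_poly u i = 0"
  shows "u = 0"
proof -
  have "u $ a = 0" for a
  proof -
    let ?I = "{b. blk b = blk a}"
    have inj: "inj_on p ?I" and ind: "independent (p ` ?I)"
      using p_basis[of "blk a"] by (auto simp: basis_family_def)
    have "(\<Sum>v\<in>p ` ?I. (u $ inv_into ?I p v) *\<^sub>R v) = block_poly u (blk a)"
      unfolding block_poly_def using inj by (simp add: sum.reindex)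
    then have "u $ inv_into ?I p (p a) = 0"
      using independentD[OF ind, of "p ` ?I" "\<lambda>v. u $ inv_into ?I p v" "p a"] assms by auto
    then show ?thesis
      using inj by simp
  qed
  then show ?thesis by (simp add: vec_eq_iff)
qed

lemma weighted_squares_in_weighted_space:
  "(\<Sum>i\<in>UNIV. w i * (block_poly u i)\<^sup>2) \<in> weighted_space w d"
  unfolding weighted_space_def power2_eq_square
  using polys_le_mult[OF block_poly_in_polys_le block_poly_in_polys_le, of u _ u]
  by (auto simp: mult_2)

text \<open>An arbitrary index set \<open>I\<close> is allowed so that one term and the sum of all
  other terms can each be placed in the cone; empty sums of squares fill the rest.\<close>

lemma weighted_squares_in_weighted_sos:
  "(\<Sum>i\<in>I. w i * (block_poly u i)\<^sup>2) \<in> weighted_sos w d"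
proof -
  define \<sigma> where "\<sigma> i = (if i \<in> I then (block_poly u i)\<^sup>2 else 0)" for i
  have "\<sigma> i \<in> sos_cone (d i)" for i
    unfolding sos_cone_def mem_Collect_eq
    by (rule exI[of _ "if i \<in> I then [block_poly u i] else []"])
      (simp add: \<sigma>_def block_poly_in_polys_le)
  moreover have "(\<Sum>i\<in>I. w i * (block_poly u i)\<^sup>2) = (\<Sum>i\<in>UNIV. w i * \<sigma> i)"
    by (simp add: \<sigma>_def if_distrib sum.If_cases cong: if_cong)
  ultimately show ?thesis
    unfolding weighted_sos_def by blast
qed

text \<open>Both sides are linear in \<open>x\<close>, and at \<open>eval_vec q z\<close> both equal
  the sum of the terms \<open>w_i(z) (p_i(z)^T u)^2\<close>.\<close>

lemma Lambda_quadratic: "u \<bullet> (\<Lambda> x *v u) = coords (\<Sum>i\<in>UNIV. w i * (block_poly u i)\<^sup>2) \<bullet> x"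
proof -
  have "(\<lambda>x. \<Lambda> x \<bullet> outer u) = (\<lambda>x. coords (\<Sum>i\<in>UNIV. w i * (block_poly u i)\<^sup>2) \<bullet> x)"
  proof (rule linear_eq_if_eq_eval_vec)
    show "linear (\<lambda>x. \<Lambda> x \<bullet> outer u)"
      by (rule linearI) (simp_all add: linear_add[OF linear_Lambda] linear_cmul[OF linear_Lambda] inner_add_left)
    show "linear (\<lambda>x. coords (\<Sum>i\<in>UNIV. w i * (block_poly u i)\<^sup>2) \<bullet> x)"
      by (rule linearI) (simp_all add: inner_add_right)
    show "\<Lambda> (eval_vec q z) \<bullet> outer u = coords (\<Sum>i\<in>UNIV. w i * (block_poly u i)\<^sup>2) \<bullet> eval_vec q z" for z
      by (simp add: Lambda_eval_vec inner_sum_left coords_inner_eval_vec weighted_squares_in_weighted_space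
          mpoly_eval_sum mpoly_eval_mult mpoly_eval_power2 mpoly_eval_block_poly outer_inner_outer)
  qed
  then show ?thesis
    by (metis inner_outer)
qed

abbreviation \<Sigma> :: "(real^'u) set" where
  "\<Sigma> \<equiv> Sigma_cone q w d"

text \<open>The quadratic form at \<open>u\<close> is the pairing with an element of the cone.
  Conversely, every element of the cone is a sum of terms \<open>w_i r^2\<close>, and each of these
  is reached by a \<open>u\<close> supported on block \<open>i\<close>.\<close>

lemma dual_cone_iff_Lambda_psd:
  "x \<in> dual_cone \<Sigma> \<longleftrightarrow> (\<forall>u. u \<bullet> (\<Lambda> x *v u) \<ge> 0)"
proof (intro iffI allI)
  fix u assume x: "x \<in> dual_cone \<Sigma>"
  have "coords (\<Sum>i\<in>UNIV. w i * (block_poly u i)\<^sup>2) \<in> \<Sigma>"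
    by (simp add: Sigma_cone_def from_coords_coords weighted_squares_in_weighted_space
        weighted_squares_in_weighted_sos)
  then show "u \<bullet> (\<Lambda> x *v u) \<ge> 0"
    using x by (simp add: dual_cone_def Lambda_quadratic)
next
  assume psd: "\<forall>u. u \<bullet> (\<Lambda> x *v u) \<ge> 0"
  have single: "coords (w i * r\<^sup>2) \<bullet> x \<ge> 0" if r: "r \<in> polys_le (d i)" for i r
  proof -
    obtain u where u: "block_poly u i = r" "\<And>j. j \<noteq> i \<Longrightarrow> block_poly u j = 0"
      using block_poly_surj[OF r] by blast
    have "(\<Sum>j\<in>UNIV. w j * (block_poly u j)\<^sup>2) = (\<Sum>j\<in>UNIV. if j = i then w i * r\<^sup>2 else 0)"
      by (rule sum.cong) (auto simp: u)
    then show ?thesis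
      using psd[rule_format, of u] by (simp add: Lambda_quadratic)
  qed
  show "x \<in> dual_cone \<Sigma>"
    unfolding dual_cone_def mem_Collect_eq
  proof
    fix s assume "s \<in> \<Sigma>"
    then obtain \<sigma> where s: "from_coords q s = (\<Sum>i\<in>UNIV. w i * \<sigma> i)" and \<sigma>: "\<And>i. \<sigma> i \<in> sos_cone (d i)"
      by (auto simp: Sigma_cone_def weighted_sos_def)
    have "\<exists>R. \<forall>i. \<sigma> i = (\<Sum>r\<leftarrow>R i. r\<^sup>2) \<and> set (R i) \<subseteq> polys_le (d i)"
      using \<sigma> unfolding sos_cone_def by (intro choice) auto
    then obtain R where R: "\<And>i. \<sigma> i = (\<Sum>r\<leftarrow>R i. r\<^sup>2)" "\<And>i. set (R i) \<subseteq> polys_le (d i)"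
      by blast
    have mem: "w i * r\<^sup>2 \<in> weighted_space w d" if "r \<in> set (R i)" for i r
      using mult_in_weighted_space[of "r * r" i] polys_le_mult[of r "d i" r "d i"] R(2)[of i] that
      by (auto simp: mult_2 power2_eq_square)
    have lin_list: "linear (\<lambda>x. \<Sum>r\<leftarrow>rs. coords (w i * r\<^sup>2) \<bullet> x)" for i rs
      by (induction rs)
        (auto intro!: linearI simp: inner_add_right algebra_simps linear_iff)
    \<comment> \<open>The decomposition of \<open>s\<close> into weighted squares, tested on
      evaluation vectors.\<close>
    have "(\<lambda>x. s \<bullet> x) = (\<lambda>x. \<Sum>i\<in>UNIV. \<Sum>r\<leftarrow>R i. coords (w i * r\<^sup>2) \<bullet> x)"
    proof (rule linear_eq_if_eq_eval_vec)
      show "linear (\<lambda>x. s \<bullet> x)"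
        by (rule linearI) (simp_all add: inner_add_right)
      show "linear (\<lambda>x. \<Sum>i\<in>UNIV. \<Sum>r\<leftarrow>R i. coords (w i * r\<^sup>2) \<bullet> x)"
        by (rule linear_compose_sum) (simp add: lin_list)
      fix z
      have "s \<bullet> eval_vec q z = mpoly_eval (from_coords q s) z"
        by (simp add: mpoly_eval_from_coords)
      also have "\<dots> = (\<Sum>i\<in>UNIV. mpoly_eval (w i) z * (\<Sum>r\<leftarrow>R i. (mpoly_eval r z)\<^sup>2))"
        by (simp add: s R(1) mpoly_eval_sum mpoly_eval_mult mpoly_eval_sum_list mpoly_eval_power2)
      also have "\<dots> = (\<Sum>i\<in>UNIV. \<Sum>r\<leftarrow>R i. coords (w i * r\<^sup>2) \<bullet> eval_vec q z)"
        by (simp add: coords_inner_eval_vec mem mpoly_eval_mult mpoly_eval_power2 sum_list_const_mult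
            cong: map_cong)
      finally show "s \<bullet> eval_vec q z = (\<Sum>i\<in>UNIV. \<Sum>r\<leftarrow>R i. coords (w i * r\<^sup>2) \<bullet> eval_vec q z)" .
    qed
    then have "s \<bullet> x = (\<Sum>i\<in>UNIV. \<Sum>r\<leftarrow>R i. coords (w i * r\<^sup>2) \<bullet> x)"
      by meson
    also have "\<dots> \<ge> 0"
      using single R(2) by (intro sum_nonneg sum_list_nonneg) auto
    finally show "s \<bullet> x \<ge> 0" .
  qed
qed

text \<open>A zero of the quadratic form at an interior point would force the weighted squares of
  \<open>u\<close> to sum to zero. Pointedness then kills each term, and since \<open>w_i\<close> is
  nonzero each block polynomial, so \<open>u = 0\<close>.\<close>

lemma Lambda_pos_def_if_interior:
  assumes pointed: "pointed \<Sigma>" and x: "x \<in> interior (dual_cone \<Sigma>)"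
  shows "pos_def (\<Lambda> x)"
  unfolding pos_def_def
proof (intro conjI allI impI)
  fix u :: "real^'l" assume "u \<noteq> 0"
  have "u \<bullet> (\<Lambda> x *v u) \<noteq> 0"
  proof
    assume 0: "u \<bullet> (\<Lambda> x *v u) = 0"
    let ?s = "\<Sum>i\<in>UNIV. w i * (block_poly u i)\<^sup>2"
    obtain e where e: "e > 0" "ball x e \<subseteq> dual_cone \<Sigma>"
      using x by (auto simp: mem_interior)
    have "coords ?s = 0"
    proof (rule ccontr)
      assume c: "coords ?s \<noteq> 0"
      \<comment> \<open>Moving from \<open>x\<close> against the functional, but inside the ball,
        makes its value negative.\<close>
      define v where "v = x - (e / 2) *\<^sub>R sgn (coords ?s)"
      have "v \<in> ball x e"
        using e c by (simp add: v_def dist_norm norm_sgn)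
      then have "u \<bullet> (\<Lambda> v *v u) \<ge> 0"
        using e dual_cone_iff_Lambda_psd by blast
      then have "coords ?s \<bullet> v \<ge> 0"
        by (simp add: Lambda_quadratic)
      moreover have "coords ?s \<bullet> v = - (e / 2) * norm (coords ?s)"
        using 0 c by (simp add: v_def inner_diff_right Lambda_quadratic sgn_div_norm dot_square_norm power2_eq_square)
      moreover have "norm (coords ?s) > 0"
        using c by simp
      ultimately show False
        using mult_pos_pos[OF e(1) \<open>norm (coords ?s) > 0\<close>] by simp
    qed
    then have s: "?s = 0"
      using from_coords_coords[OF weighted_squares_in_weighted_space, of u]
      by (simp add: linear_0[OF linear_from_coords])
    have "block_poly u i = 0" for i
    proof (rule ccontr)
      assume nz: "block_poly u i \<noteq> 0"
      let ?r = "w i * (block_poly u i)\<^sup>2"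
      have mem: "?r \<in> weighted_space w d"
        using mult_in_weighted_space[of "(block_poly u i)\<^sup>2" i]
          polys_le_mult[OF block_poly_in_polys_le block_poly_in_polys_le, of u i u i]
        by (simp add: mult_2 power2_eq_square)
      have "coords ?r \<in> \<Sigma>"
        using weighted_squares_in_weighted_sos[of u "{i}"] mem by (simp add: Sigma_cone_def from_coords_coords)
      \<comment> \<open>The weighted squares sum to zero, so the negative of one term is the sum of
        the others.\<close>
      moreover have "- coords ?r \<in> \<Sigma>"
      proof -
        have "(\<Sum>j\<in>UNIV - {i}. w j * (block_poly u j)\<^sup>2) = - ?r"
          using s by (simp add: sum.remove[of UNIV i] eq_neg_iff_add_eq_0 add.commute)
        then show ?thesis
          using weighted_squares_in_weighted_sos[of u "UNIV - {i}"] mem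
          by (simp add: Sigma_cone_def from_coords_coords linear_neg[OF linear_from_coords])
      qed
      ultimately have "coords ?r = 0"
        using pointed by (auto simp: pointed_def)
      then have "?r = 0"
        using from_coords_coords[OF mem] by (simp add: linear_0[OF linear_from_coords])
      moreover obtain z where "mpoly_eval (w i) z * mpoly_eval (block_poly u i) z \<noteq> 0"
        using mpoly_eval_mult_nonzero[OF w_nonzero nz] .
      moreover have "mpoly_eval ?r z = mpoly_eval (w i) z * (mpoly_eval (block_poly u i) z)\<^sup>2"
        by (simp add: mpoly_eval_mult mpoly_eval_power2)
      ultimately show False by simp
    qed
    then show False
      using block_poly_all_0 \<open>u \<noteq> 0\<close> by blast
  qed
  moreover have "u \<bullet> (\<Lambda> x *v u) \<ge> 0"
    using x dual_cone_iff_Lambda_psd interior_subset by blast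
  ultimately show "u \<bullet> (\<Lambda> x *v u) > 0" by simp
qed (rule transpose_Lambda)

text \<open>The points at local distance less than 1 from \<open>x\<close>, the Dikin ellipsoid,
  form an open neighbourhood inside the dual cone.\<close>

lemma interior_if_Lambda_pos_def:
  assumes "pos_def (\<Lambda> x)"
  shows "x \<in> interior (dual_cone \<Sigma>)"
proof -
  obtain C :: "real^'l^'l" where C: "congr C (\<Lambda> x) = mat 1"
    by (rule pos_def_congr_identity[OF assms])
  let ?S = "{v. norm (congr C (\<Lambda> v) - mat 1) < 1}"
  have "continuous_on UNIV (\<lambda>v. congr C (\<Lambda> v))"
    using linear_compose[OF linear_Lambda linear_congr[of C]]
    by (simp add: o_def linear_continuous_on linear_conv_bounded_linear)
  then have "open ?S"
    by (intro open_Collect_less continuous_intros)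
  moreover have "x \<in> ?S" by (simp add: C)
  moreover have "?S \<subseteq> dual_cone \<Sigma>"
    using congr_near_identity_psd[OF C] by (auto simp: dual_cone_iff_Lambda_psd)
  ultimately show ?thesis
    by (meson interiorI)
qed

text \<open>\<open>x\<close> and \<open>-x\<close> both lie in the dual cone, so \<open>x\<close> is
  orthogonal to a cone with an interior point. Injectivity is what makes the Hessian
  invertible.\<close>

lemma inj_Lambda:
  assumes "interior \<Sigma> \<noteq> {}" "\<Lambda> x = 0"
  shows "x = 0"
proof -
  have "x \<in> dual_cone \<Sigma>" "- x \<in> dual_cone \<Sigma>"
    using assms(2) by (simp_all add: dual_cone_iff_Lambda_psd linear_neg[OF linear_Lambda])
  then have 0: "s \<bullet> x = 0" if "s \<in> \<Sigma>" for s
    using that by (force simp: dual_cone_def)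
  obtain s e where e: "e > 0" "ball s e \<subseteq> \<Sigma>"
    using assms(1) by (auto simp: mem_interior)
  show ?thesis
  proof (rule ccontr)
    assume x: "x \<noteq> 0"
    have "s \<in> \<Sigma>" "s + (e / 2) *\<^sub>R sgn x \<in> \<Sigma>"
      using e x by (auto intro!: subsetD[OF e(2)] simp: dist_norm norm_sgn)
    from this[THEN 0] have "(e / 2) * (sgn x \<bullet> x) = 0"
      by (simp add: inner_add_left)
    then show False
      using e x by (simp add: sgn_div_norm)
  qed
qed

end

section \<open>Local norms\<close>

lemma sum_outer_mult_vec:
  "(\<Sum>i\<in>I. a i *\<^sub>R outer (v i)) *v x = (\<Sum>i\<in>I. (a i * (v i \<bullet> x)) *\<^sub>R v i)"
proof -
  have "linear (\<lambda>A. A *v x)"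
    by (rule linearI) (simp_all add: matrix_vector_mult_add_rdistrib scaleR_matrix_vector_assoc)
  from linear_sum[OF this, of "\<lambda>i. a i *\<^sub>R outer (v i)" I] show ?thesis
    by (simp add: scaleR_matrix_vector_assoc[symmetric] outer_mult_vec)
qed

text \<open>
  If \<open>x = M a\<close>, then \<open>x = \<Sum>\<^sub>i \<alpha>\<^sub>i (v\<^sub>i\<bullet>a) v\<^sub>i\<close>; the Cauchy-Schwarz inequality
  for the weights \<open>\<alpha>\<^sub>i\<close> bounds the seminorm of \<open>x\<close> by the geometric mean of
  \<open>x \<bullet> M\<inverse> x\<close> and \<open>t \<bullet> M t\<close>.
\<close>
lemma cond_number_bound:
  fixes v :: "'i \<Rightarrow> real^'u" and F :: "real^'u \<Rightarrow> 'b::real_normed_vector"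
  assumes M: "M = (\<Sum>i\<in>I. \<alpha> i *\<^sub>R outer (v i))" "pos_def M"
    and \<alpha>: "\<And>i. i \<in> I \<Longrightarrow> \<alpha> i \<ge> 0"
    and F: "linear F" "\<And>i. i \<in> I \<Longrightarrow> norm (F (v i)) \<le> t \<bullet> v i"
  shows "norm (F x) \<le> sqrt (cond_number M) * norm t * norm x"
proof -
  define lmin lmax where "lmin = Min (eigenvalues M)" and "lmax = Max (eigenvalues M)"
  have pos: "lmin > 0" "lmax > 0"
    using Min_Max_eigenvalues_pos[OF M(2)] by (simp_all add: lmin_def lmax_def)
  have sym: "transpose M = M" using M(2) by (simp add: pos_def_def)
  obtain C :: "real^'u^'u" where "congr C M = mat 1"
    by (rule pos_def_congr_identity[OF M(2)])
  then have "x = M *v ((C ** transpose C) *v x)"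
    by (simp add: matrix_vector_mul_assoc congr_identity_inverse)
  then obtain a where a: "x = M *v a" by blast
  have quad: "b \<bullet> (M *v b) = (\<Sum>i\<in>I. \<alpha> i * (v i \<bullet> b)\<^sup>2)" for b
    by (simp add: M(1) sum_outer_mult_vec inner_sum_right power2_eq_square inner_commute mult_ac)
  have "F x = (\<Sum>i\<in>I. (\<alpha> i * (v i \<bullet> a)) *\<^sub>R F (v i))"
    by (simp add: a M(1) sum_outer_mult_vec linear_sum[OF F(1)] linear_cmul[OF F(1)])
  then have "norm (F x) \<le> (\<Sum>i\<in>I. norm ((\<alpha> i * (v i \<bullet> a)) *\<^sub>R F (v i)))"
    by (simp only: norm_sum)
  also have "\<dots> \<le> (\<Sum>i\<in>I. (sqrt (\<alpha> i) * \<bar>v i \<bullet> a\<bar>) * (sqrt (\<alpha> i) * (t \<bullet> v i)))"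
  proof (rule sum_mono)
    fix i assume i: "i \<in> I"
    have "\<alpha> i * \<bar>v i \<bullet> a\<bar> * norm (F (v i)) \<le> \<alpha> i * \<bar>v i \<bullet> a\<bar> * (t \<bullet> v i)"
      using F(2)[OF i] \<alpha>[OF i] by (intro mult_left_mono) auto
    also have "\<dots> = (sqrt (\<alpha> i) * sqrt (\<alpha> i)) * \<bar>v i \<bullet> a\<bar> * (t \<bullet> v i)"
      using \<alpha>[OF i] by simp
    also have "\<dots> = (sqrt (\<alpha> i) * \<bar>v i \<bullet> a\<bar>) * (sqrt (\<alpha> i) * (t \<bullet> v i))"
      by (simp only: mult_ac)
    finally show "norm ((\<alpha> i * (v i \<bullet> a)) *\<^sub>R F (v i)) \<le>
        (sqrt (\<alpha> i) * \<bar>v i \<bullet> a\<bar>) * (sqrt (\<alpha> i) * (t \<bullet> v i))"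
      using \<alpha>[OF i] by (simp add: abs_mult)
  qed
  also have "\<dots> \<le> L2_set (\<lambda>i. sqrt (\<alpha> i) * \<bar>v i \<bullet> a\<bar>) I * L2_set (\<lambda>i. sqrt (\<alpha> i) * (t \<bullet> v i)) I"
    by (rule order_trans[OF _ L2_set_mult_ineq]) (simp add: sum_mono abs_mult[symmetric])
  also have "L2_set (\<lambda>i. sqrt (\<alpha> i) * \<bar>v i \<bullet> a\<bar>) I = sqrt (a \<bullet> (M *v a))"
    unfolding L2_set_def quad using \<alpha> by (simp add: power_mult_distrib)
  also have "L2_set (\<lambda>i. sqrt (\<alpha> i) * (t \<bullet> v i)) I = sqrt (t \<bullet> (M *v t))"
    unfolding L2_set_def quad using \<alpha> by (simp add: power_mult_distrib inner_commute)
  \<comment> \<open>Since \<open>x = M a\<close>, the chain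
    \<open>lmin |a|^2 \<le> a \<bullet> x \<le> |a| |x|\<close> bounds \<open>|a|\<close> by
    \<open>|x| / lmin\<close>; the other factor uses \<open>lmax\<close>.\<close>
  also have "sqrt (a \<bullet> (M *v a)) * sqrt (t \<bullet> (M *v t)) \<le> sqrt ((norm x)\<^sup>2 / lmin) * sqrt (lmax * (norm t)\<^sup>2)"
  proof -
    have le: "a \<bullet> x \<le> norm a * norm x"
      by (rule norm_cauchy_schwarz)
    have "lmin * (norm a)\<^sup>2 \<le> a \<bullet> x"
      using Min_eigenvalues_bound[OF sym, of a] by (simp add: lmin_def a dot_square_norm)
    then have "lmin * (norm a)\<^sup>2 \<le> norm a * norm x"
      using le by simp
    then have "lmin * norm a \<le> norm x"
      by (cases "norm a = 0") (simp_all add: power2_eq_square mult_ac)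
    then have "norm a \<le> norm x / lmin"
      using pos by (simp add: field_simps)
    then have "norm a * norm x \<le> (norm x)\<^sup>2 / lmin"
      using mult_right_mono[of "norm a" "norm x / lmin" "norm x"] by (simp add: power2_eq_square)
    then have 1: "a \<bullet> (M *v a) \<le> (norm x)\<^sup>2 / lmin"
      using le a by simp
    have 2: "t \<bullet> (M *v t) \<le> lmax * (norm t)\<^sup>2"
      using Max_eigenvalues_bound[OF sym, of t] by (simp add: lmax_def dot_square_norm)
    have 3: "0 \<le> b \<bullet> (M *v b)" for b
      unfolding quad using \<alpha> by (intro sum_nonneg) simp
    show ?thesis
      using 1 2 3[of t] pos by (intro mult_mono) auto
  qed
  also have "\<dots> = sqrt (cond_number M) * norm t * norm x"
    using pos by (simp add: cond_number_def lmin_def lmax_def real_sqrt_mult real_sqrt_divide)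
  finally show ?thesis .
qed

section \<open>Dual certificates near the gradient certificate\<close>

context weighted_sos_bases
begin

lemma barrier_eq: "barrier q w blk p = (\<lambda>x. - ln (det (\<Lambda> x)))"
  by (simp add: barrier_def[abs_def])

text \<open>With \<open>-g(y) = t\<close>, this represents \<open>t\<close> as the trace functional
  in the coordinates normalised at \<open>y\<close>.\<close>

lemma gradient_barrier_inner:
  fixes C :: "real^'l^'l"
  assumes C: "congr C (\<Lambda> y) = mat 1"
  shows "- gradient (barrier q w blk p) y \<bullet> v = mat 1 \<bullet> congr C (\<Lambda> v)"
proof -
  have lin: "linear (\<lambda>v. mat 1 \<bullet> congr C (\<Lambda> v))"
    by (rule linearI)
      (simp_all add: linear_add[OF linear_Lambda] linear_add[OF linear_congr]
        linear_cmul[OF linear_Lambda] linear_cmul[OF linear_congr] inner_add_right)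
  have "- gradient (barrier q w blk p) y = (\<chi> j. mat 1 \<bullet> congr C (\<Lambda> (axis j 1)))"
    by (simp add: barrier_eq log_det_gradient[OF linear_Lambda congr_identity_det_pos[OF C]]
        trace_inverse_eq_inner_congr[OF C] vec_eq_iff)
  then show ?thesis
    using linear_functional_coords[OF lin, of v] by (simp add: inner_commute)
qed

lemma hessian_barrier_inner:
  fixes C :: "real^'l^'l"
  assumes "congr C (\<Lambda> x) = mat 1"
  shows "v \<bullet> (hessian (barrier q w blk p) x *v u) = congr C (\<Lambda> u) \<bullet> congr C (\<Lambda> v)"
  unfolding barrier_eq log_det_hessian[OF linear_Lambda congr_identity_det_pos[OF assms]]
  by (rule trace_inverse_twice_eq_inner_congr[OF assms transpose_Lambda])

text \<open>A vector in the kernel of the Hessian has local norm zero, hence is zero by injectivity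
  of \<open>\<Lambda>\<close>.\<close>

lemma hessian_barrier_inverse:
  fixes C :: "real^'l^'l"
  assumes C: "congr C (\<Lambda> x) = mat 1" and "interior \<Sigma> \<noteq> {}"
  shows "hessian (barrier q w blk p) x *v (matrix_inv (hessian (barrier q w blk p) x) *v t) = t"
proof -
  let ?H = "hessian (barrier q w blk p) x"
  have "u = 0" if "?H *v u = 0" for u
  proof -
    have "congr C (\<Lambda> u) = 0"
      using hessian_barrier_inner[OF C, of u u] that by simp
    then have "\<Lambda> u = 0"
      by (rule congr_identity_inj[OF C])
    then show ?thesis
      by (rule inj_Lambda[OF assms(2)])
  qed
  then obtain B where "B ** ?H = mat 1"
    using matrix_left_invertible_ker by blast
  then have "?H ** B = mat 1"
    by (rule matrix_left_right_inverse[THEN iffD1])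
  then show ?thesis
    by (simp add: matrix_inv_eqI matrix_vector_mul_assoc)
qed

text \<open>
  The local norm of a point \<open>e\<close> of the dual cone is at most \<open>tr (\<Lambda>(y)\<inverse> \<Lambda>(e)) = t \<bullet> e\<close>,
  because a positive semidefinite matrix has Frobenius norm at most its trace.
\<close>
lemma local_norm_eval_vec:
  assumes "z \<in> nonneg_set w"
  shows "norm (congr C (\<Lambda> (eval_vec q z))) \<le> mat 1 \<bullet> congr C (\<Lambda> (eval_vec q z))"
proof -
  define b where "b i = transpose C *v block_eval_vec blk p i z" for i
  have eq: "congr C (\<Lambda> (eval_vec q z)) = (\<Sum>i\<in>UNIV. mpoly_eval (w i) z *\<^sub>R outer (b i))"
    by (simp add: Lambda_eval_vec linear_sum[OF linear_congr] linear_cmul[OF linear_congr] congr_outer b_def)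
  have "norm (congr C (\<Lambda> (eval_vec q z))) \<le> (\<Sum>i\<in>UNIV. norm (mpoly_eval (w i) z *\<^sub>R outer (b i)))"
    unfolding eq by (rule norm_sum)
  also have "\<dots> = (\<Sum>i\<in>UNIV. mpoly_eval (w i) z * (b i \<bullet> b i))"
    using assms by (simp add: nonneg_set_def norm_outer)
  also have "\<dots> = mat 1 \<bullet> congr C (\<Lambda> (eval_vec q z))"
    by (simp add: eq inner_sum_right mat_1_inner_outer)
  finally show ?thesis .
qed

text \<open>
  Write \<open>u = H(x)\<inverse> t\<close>. Pairing \<open>H(x)(u - x) = g(x) - g(y)\<close> with \<open>u - x\<close> shows that the
  local norm of \<open>u - x\<close> at \<open>x\<close> is at most that of \<open>x - y\<close> at \<open>y\<close>; a point within local
  distance 1 of \<open>x\<close> lies in the dual cone.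
\<close>
lemma dual_certificate_near_gradient_certificate:
  fixes C :: "real^'l^'l"
  assumes y: "gradient_certificate q w d blk p y t"
    and C: "congr C (\<Lambda> y) = mat 1"
    and near: "norm (congr C (\<Lambda> (x - y))) < 1"
  shows "dual_certificate q w d blk p x t"
proof -
  have congr_diff: "congr C' (\<Lambda> (a - b)) = congr C' (\<Lambda> a) - congr C' (\<Lambda> b)" for C' :: "real^'l^'l" and a b
    by (simp add: linear_diff[OF linear_Lambda] linear_diff[OF linear_congr])
  have near': "norm (congr C (\<Lambda> x) - mat 1) < 1"
    using near by (simp add: congr_diff C)
  then have pd: "pos_def (\<Lambda> x)"
    by (rule congr_near_identity_pos_def[OF C _ transpose_Lambda])
  obtain C' :: "real^'l^'l" where C': "congr C' (\<Lambda> x) = mat 1"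
    by (rule pos_def_congr_identity[OF pd])
  \<comment> \<open>\<open>Z\<close> represents \<open>t\<close> in the coordinates normalised at
    \<open>x\<close>, and its distance to the identity is the local distance of \<open>x\<close>
    from \<open>y\<close>.\<close>
  obtain Z where Z: "norm (Z - mat 1) = norm (congr C (\<Lambda> x) - mat 1)"
    "\<And>F. Z \<bullet> congr C' F = mat 1 \<bullet> congr C F"
    using norm_congr_swap[OF C C'] by blast
  have t: "t \<in> interior \<Sigma>" "- gradient (barrier q w blk p) y = t"
    using y by (auto simp: gradient_certificate_def)
  define u where "u = matrix_inv (hessian (barrier q w blk p) x) *v t"
  have Hu: "hessian (barrier q w blk p) x *v u = t"
    unfolding u_def using hessian_barrier_inverse[OF C'] t(1) by blast
  \<comment> \<open>Both sides equal \<open>t \<bullet> v\<close>: the left by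
    \<open>H(x) u = t\<close>, the right by the representation through \<open>Z\<close>.\<close>
  have tu: "congr C' (\<Lambda> u) \<bullet> congr C' (\<Lambda> v) = Z \<bullet> congr C' (\<Lambda> v)" for v
    using hessian_barrier_inner[OF C', of v u] gradient_barrier_inner[OF C, of v]
    by (simp add: Hu Z(2) t(2) inner_commute)
  define W where "W = congr C' (\<Lambda> (u - x))"
  have W: "W = congr C' (\<Lambda> u) - mat 1"
    by (simp add: W_def congr_diff C')
  \<comment> \<open>\<open>W\<close> is itself of the form \<open>congr C' (\<Lambda> v)\<close>, so
    \<open>Z\<close> may replace \<open>congr C' (\<Lambda> u)\<close> in the pairing;
    Cauchy-Schwarz then gives \<open>|W| \<le> |Z - I|\<close>.\<close>
  have "W \<bullet> W = (Z - mat 1) \<bullet> W"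
    using tu[of "u - x"] by (simp add: W inner_diff_left flip: W_def)
  also have "\<dots> \<le> norm (Z - mat 1) * norm W"
    by (rule norm_cauchy_schwarz)
  finally have "norm W * norm W \<le> norm (Z - mat 1) * norm W"
    by (simp add: dot_square_norm power2_eq_square)
  then have "norm W \<le> norm (Z - mat 1)"
    by (cases "W = 0") simp_all
  then have "norm (congr C' (\<Lambda> u) - mat 1) \<le> 1"
    using near' by (simp add: W Z(1))
  then have "u \<in> dual_cone \<Sigma>"
    using congr_near_identity_psd[OF C'] by (auto simp: dual_cone_iff_Lambda_psd)
  moreover have "t \<in> \<Sigma>"
    using t(1) interior_subset by blast
  ultimately show ?thesis
    using interior_if_Lambda_pos_def[OF pd] by (simp add: dual_certificate_def u_def)
qed

end

theorem theorem2p4: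
  fixes w :: "'m::finite \<Rightarrow> 'n::finite mpoly"
    and d :: "'m \<Rightarrow> nat"
    and q :: "'u::finite \<Rightarrow> 'n mpoly"
    and blk :: "'l::finite \<Rightarrow> 'm"
    and p :: "'l \<Rightarrow> 'n mpoly"
    and t y yN :: "real^'u"
    and s :: nat
    and z :: "nat \<Rightarrow> real^'n"
    and \<alpha> :: "nat \<Rightarrow> real"
    and M :: "real^'u^'u"
    and N :: int
  assumes w_nonzero: "\<And>i. w i \<noteq> 0"
    and q_basis: "basis_family UNIV q (weighted_space w d)"
    and p_basis: "\<And>i. basis_family {a. blk a = i} p (polys_le (d i))"
    and Sigma_closed: "closed (Sigma_cone q w d)"
    and Sigma_pointed: "pointed (Sigma_cone q w d)"
    and t_interior: "t \<in> interior (Sigma_cone q w d)"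
    and y_certificate: "gradient_certificate q w d blk p y t"
    and z_in_S: "z ` {1..s} \<subseteq> nonneg_set w"
    and z_unisolvent: "unisolvent (z ` {1..s}) (weighted_space w d)"
    and \<alpha>_pos: "\<And>i. i \<in> {1..s} \<Longrightarrow> \<alpha> i > 0"
    and M_eq: "M = (\<Sum>i=1..s. \<alpha> i *\<^sub>R outer (eval_vec q (z i)))"
    and N_eq: "N = \<lceil>3 / 2 * sqrt (real CARD('u) * cond_number M) * norm t\<rceil>"
    and yN_grid: "\<forall>j. \<exists>k::int. yN $ j = of_int k / of_int N"
    and yN_close: "norm (yN - y) \<le> sqrt (real CARD('u)) / (2 * of_int N)"
  shows "dual_certificate q w d blk p yN t"
proof -
  interpret weighted_sos_bases w d q blk p "z ` {1..s}"
    by unfold_locales (fact w_nonzero q_basis p_basis z_unisolvent)+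
  have "pos_def (\<Lambda> y)"
    using Lambda_pos_def_if_interior[OF Sigma_pointed] y_certificate
    by (simp add: gradient_certificate_def)
  then obtain C :: "real^'l^'l" where C: "congr C (\<Lambda> y) = mat 1"
    by (rule pos_def_congr_identity)
  have t: "t \<bullet> v = mat 1 \<bullet> congr C (\<Lambda> v)" for v
    using gradient_barrier_inner[OF C, of v] y_certificate unfolding gradient_certificate_def by metis
  have \<alpha>_nonneg: "\<alpha> i \<ge> 0" if "i \<in> {1..s}" for i
    using \<alpha>_pos[OF that] by simp
  \<comment> \<open>\<open>v^T M v\<close> is a positively weighted sum of squared values, at the
    points \<open>z i\<close>, of the polynomial with coefficients \<open>v\<close>; unisolvence
    makes one of them nonzero.\<close>
  have M_pos_def: "pos_def M"
    unfolding pos_def_def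
  proof (intro conjI allI impI)
    show "transpose M = M"
      by (simp add: M_eq transpose_def vec_eq_iff outer_component mult.commute)
    fix v :: "real^'u" assume "v \<noteq> 0"
    then obtain i where i: "i \<in> {1..s}" "v \<bullet> eval_vec q (z i) \<noteq> 0"
      using eval_vec_separates[of v] by blast
    have "v \<bullet> (M *v v) = (\<Sum>i=1..s. \<alpha> i * (v \<bullet> eval_vec q (z i))\<^sup>2)"
      by (simp add: M_eq sum_outer_mult_vec inner_sum_right power2_eq_square inner_commute mult_ac)
    also have "\<dots> > 0"
      by (rule sum_pos2[of _ i]) (use i \<alpha>_pos \<alpha>_nonneg in simp_all)
    finally show "v \<bullet> (M *v v) > 0" .
  qed
  have linear: "linear (\<lambda>v. congr C (\<Lambda> v))"
    using linear_compose[OF linear_Lambda linear_congr[of C]] by (simp add: o_def)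
  have "norm (congr C (\<Lambda> (yN - y))) \<le> sqrt (cond_number M) * norm t * norm (yN - y)"
  proof (rule cond_number_bound[OF M_eq M_pos_def _ linear])
    show "norm (congr C (\<Lambda> (eval_vec q (z i)))) \<le> t \<bullet> eval_vec q (z i)" if "i \<in> {1..s}" for i
      unfolding t using z_in_S that by (intro local_norm_eval_vec) auto
  qed (rule \<alpha>_nonneg)
  also have "\<dots> \<le> sqrt (cond_number M) * norm t * (sqrt (real CARD('u)) / (2 * of_int N))"
    using yN_close Min_Max_eigenvalues_pos[OF M_pos_def]
    by (intro mult_left_mono) (simp_all add: cond_number_def)
  \<comment> \<open>Isolates the quantity that \<open>N\<close> rounds up: as
    \<open>1/2 = (3/2)/3\<close>, the bound is one third of its quotient by
    \<open>N\<close>.\<close>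
  also have "\<dots> = 3 / 2 * sqrt (real CARD('u) * cond_number M) * norm t / of_int N / 3"
    by (simp add: real_sqrt_mult)
  also have "\<dots> < 1"
  proof -
    have third: "a / 3 < 1" if "a \<le> 1" for a :: real
      using that by simp
    let ?c = "3 / 2 * sqrt (real CARD('u) * cond_number M) * norm t"
    have c: "0 \<le> ?c" "?c \<le> of_int N"
      using Min_Max_eigenvalues_pos[OF M_pos_def] by (simp_all add: N_eq cond_number_def)
    have "?c / of_int N \<le> of_int N / of_int N"
      by (rule divide_right_mono) (use c in linarith)+
    \<comment> \<open>This also covers \<open>N = 0\<close>, where the quotient is 0 by
      convention.\<close>
    also have "\<dots> \<le> 1" by simp
    finally show ?thesis
      by (rule third)
  qed
  finally show ?thesis
    by (rule dual_certificate_near_gradient_certificate[OF y_certificate C])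
qed

end
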